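(* Let $p>2$, $\lambda\in(0,1)$, and let $\Omega\subset\mathbb{R}^n$ be open and bounded with $\mathcal{C}^2$ boundary. Let $f\in\mathcal{C}(\overline\Omega)$ be nonnegative, with compact support contained in $\Omega$, and semiconcave in $\Omega$. Let $u$ and $u^\varepsilon$ be the viscosity solutions of the state-constraint problems $(\mathrm{SC}_0)$ and $(\mathrm{SC}_\varepsilon)$. Then for every $\varepsilon>0$ sufficiently small, $$\max_{x\in\overline\Omega}\{u^\varepsilon(x)-u(x)\}\ \le\ \Big(\frac1\lambda+\frac{2^{\alpha_p}}{\alpha_p}\Big)\varepsilon^{1-\frac{\alpha_p}{2}},\qquad \alpha_p=\frac{p-2}{p-1}.$$
   Context: A function $f:\Omega\to\mathbb R$ is semiconcave (with linear modulus, constant $K$) if for all $x,y$ with segment $[x,y]\subset\Omega$ and all $t\in[0,1]$: $tf(x)+(1-t)f(y)-f(tx+(1-t)y)\le t(1-t)\frac{K|x-y|^2}{2}$. For $\varepsilon\ge0$, a viscosity solution of the state-constraint problem $(\mathrm{SC}_\varepsilon)$: $\lambda u+|Du|^p-\varepsilon\Delta u=f$ in $\Omega$, $\lambda u+|Du|^p-\varepsilon\Delta u\ge f$ on $\partial\Omega$, is a function $u\in\mathcal{C}(\overline\Omega)$ which is a viscosity subsolution in $\Omega$ (for every $\varphi\in\mathcal C^2$ ($\mathcal C^1$ if $\varepsilon=0$) with $u-\varphi$ having a local maximum at $x_0\in\Omega$: $\lambda u(x_0)+|D\varphi(x_0)|^p-\varepsilon\Delta\varphi(x_0)\le f(x_0)$)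 and a viscosity supersolution on $\overline\Omega$ (for every such $\varphi$ with $u-\varphi$ having a local minimum relative to $\overline\Omega$ at $x_0\in\overline\Omega$: $\ge f(x_0)$). Such solutions exist and are unique; for $\varepsilon>0$, $u^\varepsilon\in\mathcal C^2(\Omega)\cap\mathcal C(\overline\Omega)$. *)

theory Defs
  imports "HOL-Analysis.Analysis"
begin

definition pderiv_dir :: "('a::euclidean_space \<Rightarrow> real) \<Rightarrow> 'a \<Rightarrow> 'a \<Rightarrow> real" where
  "pderiv_dir \<phi> b x = frechet_derivative \<phi> (at x) b"

definition grad :: "('a::euclidean_space \<Rightarrow> real) \<Rightarrow> 'a \<Rightarrow> 'a" where
  "grad \<phi> x = (\<Sum>b\<in>Basis. pderiv_dir \<phi> b x *\<^sub>R b)"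

definition laplacian :: "('a::euclidean_space \<Rightarrow> real) \<Rightarrow> 'a \<Rightarrow> real" where
  "laplacian \<phi> x = (\<Sum>b\<in>Basis. pderiv_dir (pderiv_dir \<phi> b) b x)"

definition C1_fun :: "('a::euclidean_space \<Rightarrow> real) \<Rightarrow> bool" where
  "C1_fun \<phi> \<longleftrightarrow> (\<forall>x. \<phi> differentiable (at x)) \<and>
     (\<forall>b\<in>Basis. continuous_on UNIV (pderiv_dir \<phi> b))"

definition C2_fun :: "('a::euclidean_space \<Rightarrow> real) \<Rightarrow> bool" where
  "C2_fun \<phi> \<longleftrightarrow> C1_fun \<phi> \<and> (\<forall>b\<in>Basis. C1_fun (pderiv_dir \<phi> b))"

definition C2_boundary :: "'a::euclidean_space set \<Rightarrow> bool" where
  "C2_boundary \<Omega> \<longleftrightarrow> (\<forall>x0\<in>frontier \<Omega>. \<exists>r>0. \<exists>\<rho>. C2_fun \<rho> \<and> grad \<rho> x0 \<noteq> 0 \<and>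
      (\<forall>x\<in>ball x0 r. x \<in> \<Omega> \<longleftrightarrow> \<rho> x < 0))"

definition semiconcave_on :: "'a::euclidean_space set \<Rightarrow> ('a \<Rightarrow> real) \<Rightarrow> bool" where
  "semiconcave_on \<Omega> f \<longleftrightarrow> (\<exists>K. \<forall>x y t. closed_segment x y \<subseteq> \<Omega> \<longrightarrow> t \<in> {0..1} \<longrightarrow>
      t * f x + (1 - t) * f y - f (t *\<^sub>R x + (1 - t) *\<^sub>R y) \<le> t * (1 - t) * (K * (norm (x - y))\<^sup>2 / 2))"

definition test_fun :: "real \<Rightarrow> ('a::euclidean_space \<Rightarrow> real) \<Rightarrow> bool" where
  "test_fun \<epsilon> \<phi> \<longleftrightarrow> (if \<epsilon> = 0 then C1_fun \<phi> else C2_fun \<phi>)"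

text \<open>Viscosity solution of the state-constraint problem
  lam u + |Du|^p - eps Lap u = f in Omega, >= f on the boundary.\<close>
definition SC_solution ::
  "real \<Rightarrow> real \<Rightarrow> real \<Rightarrow> 'a::euclidean_space set \<Rightarrow> ('a \<Rightarrow> real) \<Rightarrow> ('a \<Rightarrow> real) \<Rightarrow> bool" where
  "SC_solution lam p \<epsilon> \<Omega> f u \<longleftrightarrow>
     continuous_on (closure \<Omega>) u \<and>
     (\<forall>\<phi> x0. test_fun \<epsilon> \<phi> \<longrightarrow> x0 \<in> \<Omega> \<longrightarrow>
        (\<exists>r>0. \<forall>x\<in>ball x0 r \<inter> \<Omega>. u x - \<phi> x \<le> u x0 - \<phi> x0) \<longrightarrow>
        lam * u x0 + norm (grad \<phi> x0) powr p - \<epsilon> * laplacian \<phi> x0 \<le> f x0) \<and>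
     (\<forall>\<phi> x0. test_fun \<epsilon> \<phi> \<longrightarrow> x0 \<in> closure \<Omega> \<longrightarrow>
        (\<exists>r>0. \<forall>x\<in>ball x0 r \<inter> closure \<Omega>. u x - \<phi> x \<ge> u x0 - \<phi> x0) \<longrightarrow>
        lam * u x0 + norm (grad \<phi> x0) powr p - \<epsilon> * laplacian \<phi> x0 \<ge> f x0)"

end

theory Submission
  imports Defs
begin

text \<open>
  Since \<open>f\<close> vanishes near the boundary, \<open>u = 0\<close> off the support of \<open>f\<close>; extending \<open>u\<close> and \<open>f\<close> by zero
  gives a solution on the whole space, and a tripling of variables shows that it is semiconcave.
  If \<open>u\<epsilon> - u\<close> has its maximum at an interior point, semiconcavity bounds the second derivatives of
  test functions for \<open>u\<epsilon>\<close> there, and comparing the two equations gives a bound of order \<open>\<epsilon>\<close>, which is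
  \<open>o(\<epsilon> powr (1 - \<alpha> / 2))\<close>. On the boundary it suffices to bound \<open>u\<epsilon>\<close>: by the interior ball
  condition every boundary point lies on a sphere of fixed radius bounding a ball in which \<open>f = 0\<close>, and
  on such a ball \<open>u\<epsilon>\<close> is compared with a radial barrier
  \<open>\<epsilon> powr (1 - \<alpha> / 2) * (1 / lam + W ((R - r) / sqrt \<epsilon>))\<close> whose slope explodes on the sphere.
\<close>


subsection \<open>Quadratic test functions\<close>

text \<open>On the boundary \<open>u\<epsilon>\<close> satisfies only the supersolution inequality,
  which gives no bound from above. The barrier must therefore prevent contact on the sphere by
  itself: a logarithmic term makes it infinite there, and the weight of that term is sent to zero
  after the comparison. The amplitude \<open>D = \<epsilon> powr (1 - \<alpha> / 2)\<close> and the
  length \<open>\<delta> = sqrt \<epsilon>\<close> are matched so that the gradient scale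
  \<open>(D / \<delta>) powr p\<close> and the diffusion scale
  \<open>\<epsilon> * D / \<delta>\<^sup>2\<close> both equal \<open>D\<close>. Dividing by
  \<open>D\<close> leaves an inequality for the profile alone: second derivative at most slope to
  the power \<open>p\<close>, plus 1. The summand \<open>1 / lam\<close> pays for that 1, and
  \<open>2 powr \<alpha> / \<alpha>\<close> bounds the height of the profile. Working on balls keeps
  the barrier radial and explicit. The price is a curvature term with coefficient of order
  \<open>sqrt \<epsilon>\<close>, which is absorbed because the profile inequality has a strict
  surplus for \<open>p > 2\<close>.\<close>

text \<open>
  Second-order test functions are global \<open>C\<^sup>2\<close> functions, so barriers and paraboloids that are only
  defined near the point of contact enter through the quadratic polynomials \<open>quad\<close>.
\<close>

definition quad :: "'a::euclidean_space \<Rightarrow> real \<Rightarrow> real \<Rightarrow> 'a \<Rightarrow> 'a \<Rightarrow> 'a \<Rightarrow> real" where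
  "quad q K m \<nu> x0 x = q \<bullet> (x - x0) + K * ((x - x0) \<bullet> (x - x0)) + m * (\<nu> \<bullet> (x - x0))\<^sup>2"

lemma has_derivative_quad:
  "(quad q K m \<nu> x0 has_derivative
    (\<lambda>h. q \<bullet> h + 2 * K * ((x - x0) \<bullet> h) + 2 * m * (\<nu> \<bullet> (x - x0)) * (\<nu> \<bullet> h))) (at x)"
  unfolding quad_def
  by (auto intro!: derivative_eq_intros ext simp: inner_commute algebra_simps power2_eq_square)

lemma pderiv_dir_eq:
  assumes "(f has_derivative f') (at x)"
  shows "pderiv_dir f b x = f' b"
  using frechet_derivative_at[OF assms] by (simp add: pderiv_dir_def)

lemma pderiv_dir_quad:
  "pderiv_dir (quad q K m \<nu> x0) b =
    (\<lambda>x. q \<bullet> b + 2 * K * ((x - x0) \<bullet> b) + 2 * m * (\<nu> \<bullet> (x - x0)) * (\<nu> \<bullet> b))"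
  using pderiv_dir_eq[OF has_derivative_quad] by (intro ext) blast

lemma has_derivative_pderiv_dir_quad:
  "(pderiv_dir (quad q K m \<nu> x0) b has_derivative
    (\<lambda>h. 2 * K * (h \<bullet> b) + 2 * m * (\<nu> \<bullet> h) * (\<nu> \<bullet> b))) (at x)"
  unfolding pderiv_dir_quad
  by (auto intro!: derivative_eq_intros ext simp: algebra_simps)

lemma pderiv_dir_pderiv_dir_quad:
  "pderiv_dir (pderiv_dir (quad q K m \<nu> x0) b) c =
    (\<lambda>x. 2 * K * (c \<bullet> b) + 2 * m * (\<nu> \<bullet> c) * (\<nu> \<bullet> b))"
  using pderiv_dir_eq[OF has_derivative_pderiv_dir_quad] by (intro ext) blast

lemma C2_fun_quad: "C2_fun (quad q K m \<nu> x0)"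
  unfolding C2_fun_def C1_fun_def pderiv_dir_pderiv_dir_quad
  using has_derivative_quad has_derivative_pderiv_dir_quad
  by (auto simp: differentiable_def pderiv_dir_quad intro!: continuous_intros) blast+

lemma grad_quad: "grad (quad q K m \<nu> x0) x0 = q"
  by (simp add: grad_def pderiv_dir_quad euclidean_representation)

lemma laplacian_quad:
  "laplacian (quad q K m \<nu> x0) x = 2 * DIM('a) * K + 2 * m * (norm \<nu>)\<^sup>2"
  for x0 :: "'a::euclidean_space" and K :: real
proof -
  have "laplacian (quad q K m \<nu> x0) x = (\<Sum>b\<in>Basis. 2 * K + 2 * m * (\<nu> \<bullet> b * (\<nu> \<bullet> b)))"
    unfolding laplacian_def pderiv_dir_pderiv_dir_quad by (intro sum.cong) auto
  also have "\<dots> = 2 * DIM('a) * K + 2 * m * (\<nu> \<bullet> \<nu>)"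
    by (simp add: sum.distrib euclidean_inner[of \<nu> \<nu>] flip: sum_distrib_left)
  finally show ?thesis
    by (simp add: power2_norm_eq_inner)
qed

lemma C2_imp_test_fun: "C2_fun \<phi> \<Longrightarrow> test_fun \<epsilon> \<phi>"
  by (simp add: test_fun_def C2_fun_def)

text \<open>The rank-one term along \<open>\<nu>\<close> serves the radial barrier, whose second
  derivative is large in the radial direction only. Elsewhere an isotropic paraboloid suffices and
  \<open>m\<close> is set to 0.\<close>

lemma subsolution_quad:
  fixes x0 :: "'a::euclidean_space" and K :: real
  assumes sol: "SC_solution lam p \<epsilon> \<Omega> f u" and x0: "x0 \<in> \<Omega>"
    and touch: "\<forall>\<^sub>F x in nhds x0. x \<in> \<Omega> \<longrightarrow>
      u x \<le> u x0 + q \<bullet> (x - x0) + K * ((x - x0) \<bullet> (x - x0)) + m * (\<nu> \<bullet> (x - x0))\<^sup>2"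
  shows "lam * u x0 + norm q powr p - \<epsilon> * (2 * DIM('a) * K + 2 * m * (norm \<nu>)\<^sup>2) \<le> f x0"
proof -
  obtain r where "r > 0" and r: "\<And>x. dist x x0 < r \<Longrightarrow> x \<in> \<Omega> \<Longrightarrow>
      u x \<le> u x0 + q \<bullet> (x - x0) + K * ((x - x0) \<bullet> (x - x0)) + m * (\<nu> \<bullet> (x - x0))\<^sup>2"
    using touch unfolding eventually_nhds_metric by blast
  have "\<exists>r>0. \<forall>x\<in>ball x0 r \<inter> \<Omega>. u x - quad q K m \<nu> x0 x \<le> u x0 - quad q K m \<nu> x0 x0"
    using \<open>r > 0\<close> r by (intro exI[of _ r]) (force simp: quad_def dist_commute algebra_simps)
  then have "lam * u x0 + norm (grad (quad q K m \<nu> x0) x0) powr p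
      - \<epsilon> * laplacian (quad q K m \<nu> x0) x0 \<le> f x0"
    using sol x0 C2_imp_test_fun[OF C2_fun_quad] unfolding SC_solution_def by blast
  then show ?thesis
    by (simp add: grad_quad laplacian_quad)
qed

text \<open>Without viscosity the Laplacian is multiplied by zero, so only the slope of the touching
  paraboloid enters and \<open>K\<close> may be arbitrarily negative.\<close>

lemma supersolution_quad:
  fixes x0 :: "'a::euclidean_space" and K :: real
  assumes sol: "SC_solution lam p 0 \<Omega> f u" and x0: "x0 \<in> closure \<Omega>"
    and touch: "\<forall>\<^sub>F x in nhds x0. x \<in> closure \<Omega> \<longrightarrow>
      u x \<ge> u x0 + q \<bullet> (x - x0) + K * ((x - x0) \<bullet> (x - x0))"
  shows "lam * u x0 + norm q powr p \<ge> f x0"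
proof -
  let ?Q = "quad q K 0 0 x0"
  obtain r where "r > 0" and r: "\<And>x. dist x x0 < r \<Longrightarrow> x \<in> closure \<Omega> \<Longrightarrow>
      u x \<ge> u x0 + q \<bullet> (x - x0) + K * ((x - x0) \<bullet> (x - x0))"
    using touch unfolding eventually_nhds_metric by blast
  have "\<exists>r>0. \<forall>x\<in>ball x0 r \<inter> closure \<Omega>. u x - ?Q x \<ge> u x0 - ?Q x0"
    using \<open>r > 0\<close> r by (intro exI[of _ r]) (force simp: quad_def dist_commute algebra_simps)
  then have "lam * u x0 + norm (grad ?Q x0) powr p - 0 * laplacian ?Q x0 \<ge> f x0"
    using sol x0 C2_imp_test_fun[OF C2_fun_quad] unfolding SC_solution_def by blast
  then show ?thesis
    by (simp add: grad_quad)
qed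

text \<open>After subtracting the affine part, semiconcavity reads
  \<open>g (2 h) <= 2 * g h + C * (norm h)\<^sup>2\<close>; halving \<open>h\<close> repeatedly sums
  a geometric series to \<open>C / 2 * (norm h)\<^sup>2\<close>. The remaining term vanishes in the
  limit, since contact from below at \<open>- k\<close> and semiconcavity make \<open>g k\<close>
  quadratically small. The point is that the opening \<open>B\<close> of the contact, which depends
  on the penalisation, is replaced by \<open>C / 2\<close>, and local contact by a global
  bound.\<close>

lemma paraboloid_upper_bound_of_semiconcave:
  fixes U :: "'a::real_inner \<Rightarrow> real"
  assumes sc: "\<And>y h. U (y + h) + U (y - h) - 2 * U y \<le> C * (norm h)\<^sup>2"
    and "r > 0"
    and below: "\<And>k. norm k < r \<Longrightarrow> U (y + k) \<ge> U y + q \<bullet> k - B * (norm k)\<^sup>2"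
  shows "U (y + h) \<le> U y + q \<bullet> h + C / 2 * (norm h)\<^sup>2"
proof -
  define g where "g h = U (y + h) - U y - q \<bullet> h" for h
  have double: "g (2 *\<^sub>R h) \<le> 2 * g h + C * (norm h)\<^sup>2" for h
    using sc[of "y + h" h] by (simp add: g_def scaleR_2 inner_add_right algebra_simps)
  have small: "g k \<le> (B + C) * (norm k)\<^sup>2" if "norm k < r" for k
    using sc[of y k] below[of "- k"] that by (simp add: g_def algebra_simps)
  have iter: "g h \<le> 2 ^ k * g ((1 / 2 ^ k) *\<^sub>R h) + C / 2 * (norm h)\<^sup>2 * (1 - 1 / 2 ^ k)" for k
  proof (induction k)
    case (Suc k)
    have "g ((1 / 2 ^ k) *\<^sub>R h) \<le> 2 * g ((1 / 2 ^ Suc k) *\<^sub>R h) + C * (norm ((1 / 2 ^ Suc k) *\<^sub>R h))\<^sup>2"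
      using double[of "(1 / 2 ^ Suc k) *\<^sub>R h"] by simp
    then have "2 ^ k * g ((1 / 2 ^ k) *\<^sub>R h) \<le> 2 ^ k * (2 * g ((1 / 2 ^ Suc k) *\<^sub>R h) + C * (norm ((1 / 2 ^ Suc k) *\<^sub>R h))\<^sup>2)"
      by (intro mult_left_mono) auto
    also have "\<dots> = 2 ^ Suc k * g ((1 / 2 ^ Suc k) *\<^sub>R h) + C / 4 * (norm h)\<^sup>2 * (1 / 2 ^ k)"
      by (simp add: power_mult_distrib power_divide field_simps power2_eq_square)
    finally show ?case
      using Suc by (simp add: field_simps)
  qed simp
  have lim0: "(\<lambda>k. (1 / 2) ^ k * norm h) \<longlonglongrightarrow> 0"
    by (rule tendsto_mult_left_zero) (simp add: LIMSEQ_realpow_zero)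
  have "\<forall>\<^sub>F k in sequentially. (1 / 2) ^ k * norm h < r"
    using order_tendstoD(2)[OF lim0 \<open>r > 0\<close>] .
  then have "\<forall>\<^sub>F k in sequentially. g h \<le> (B + C) * (norm h)\<^sup>2 * (1 / 2) ^ k
      + C / 2 * (norm h)\<^sup>2 * (1 - (1 / 2) ^ k)"
  proof eventually_elim
    case (elim k)
    then have "norm ((1 / 2 ^ k) *\<^sub>R h) < r"
      by (simp add: power_divide)
    from small[OF this]
    have "2 ^ k * g ((1 / 2 ^ k) *\<^sub>R h) \<le> 2 ^ k * ((B + C) * (norm ((1 / 2 ^ k) *\<^sub>R h))\<^sup>2)"
      by (intro mult_left_mono) auto
    also have "\<dots> = (B + C) * (norm h)\<^sup>2 * (1 / 2) ^ k"
      by (simp add: power_mult_distrib power_divide field_simps power2_eq_square)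
    finally show ?case
      using iter[of k] by (simp add: power_divide)
  qed
  moreover have "(\<lambda>k. (B + C) * (norm h)\<^sup>2 * (1 / 2) ^ k + C / 2 * (norm h)\<^sup>2 * (1 - (1 / 2) ^ k))
      \<longlonglongrightarrow> (B + C) * (norm h)\<^sup>2 * 0 + C / 2 * (norm h)\<^sup>2 * (1 - 0)"
    by (intro tendsto_intros) (simp_all add: LIMSEQ_realpow_zero)
  ultimately have "g h \<le> (B + C) * (norm h)\<^sup>2 * 0 + C / 2 * (norm h)\<^sup>2 * (1 - 0)"
    by (intro tendsto_lowerbound) auto
  then show ?thesis
    by (simp add: g_def)
qed

subsection \<open>The one-dimensional barrier\<close>

lemma powr_ge_tangent_at_1:
  fixes v p :: real
  assumes "v \<ge> 0" "p > 1"
  shows "v powr p \<ge> 1 + p * (v - 1)"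
proof (cases "v = 0")
  case False
  have "(v powr p) powr (1 / p) * 1 powr (1 - 1 / p) \<le> (1 / p) * v powr p + (1 - 1 / p) * 1"
    using assms False by (intro Youngs_inequality_0) auto
  then have "v \<le> v powr p / p + 1 - 1 / p"
    using assms False by (simp add: powr_powr)
  then have "p * v \<le> p * (v powr p / p + 1 - 1 / p)"
    using assms by (intro mult_left_mono) auto
  also have "\<dots> = v powr p + p - 1"
    using assms by (simp add: algebra_simps)
  finally show ?thesis
    by (simp add: algebra_simps)
qed (use assms in simp)

text \<open>The tangent line at \<open>x\<close>, obtained by rescaling to the tangent at 1. It
  isolates the first-order gain of the gradient term from the logarithmic part of the
  barrier.\<close>

lemma powr_add_ge:
  fixes x y p :: real
  assumes "x \<ge> 0" "y \<ge> 0" "p > 1"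
  shows "(x + y) powr p \<ge> x powr p + p * x powr (p - 1) * y"
proof (cases "x = 0")
  case False
  with assms have "x > 0" by simp
  have "x + y = x * (1 + y / x)"
    using \<open>x > 0\<close> by (simp add: field_simps)
  then have "(x + y) powr p = x powr p * (1 + y / x) powr p"
    using \<open>x > 0\<close> assms by (metis powr_mult)
  also have "\<dots> \<ge> x powr p * (1 + p * (y / x))"
    using powr_ge_tangent_at_1[of "1 + y / x" p] assms by (intro mult_left_mono) auto
  also have "x powr p * (1 + p * (y / x)) = x powr p + p * x powr (p - 1) * y"
    using \<open>x > 0\<close> by (simp add: powr_diff field_simps)
  finally show ?thesis .
qed (use assms in auto)

text \<open>Both norms are compared with the tangent at their mean \<open>m\<close>, where the two
  linear increments cancel.\<close>

lemma norm_midpoint_powr_le: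
  fixes a b :: "'a::real_normed_vector"
  assumes "p > 1"
  shows "2 * norm ((1 / 2) *\<^sub>R (a + b)) powr p \<le> norm a powr p + norm b powr p"
proof -
  define m where "m = (norm a + norm b) / 2"
  have "norm ((1 / 2) *\<^sub>R (a + b)) \<le> m"
    using norm_triangle_ineq[of a b] by (simp add: m_def)
  then have 1: "norm ((1 / 2) *\<^sub>R (a + b)) powr p \<le> m powr p"
    using assms by (intro powr_mono2) auto
  have 2: "2 * m powr p \<le> norm a powr p + norm b powr p"
  proof (cases "m = 0")
    case False
    then have "m > 0"
      by (simp add: m_def add_nonneg_eq_0_iff less_le)
    have "m powr p * (1 + p * (c / m - 1)) \<le> c powr p" if "c \<ge> 0" for c
    proof -
      have "m powr p * (1 + p * (c / m - 1)) \<le> m powr p * (c / m) powr p"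
        using powr_ge_tangent_at_1[of "c / m" p] \<open>m > 0\<close> assms that by (intro mult_left_mono) auto
      then show ?thesis
        using \<open>m > 0\<close> that by (simp add: powr_mult[symmetric])
    qed
    from this[of "norm a"] this[of "norm b"]
    have "m powr p * ((1 + p * (norm a / m - 1)) + (1 + p * (norm b / m - 1)))
        \<le> norm a powr p + norm b powr p"
      by (simp only: distrib_left) simp
    moreover have "(1 + p * (norm a / m - 1)) + (1 + p * (norm b / m - 1)) = 2"
    proof -
      have "norm a / m + norm b / m = 2"
        using \<open>m > 0\<close> by (metis add_divide_distrib divide_eq_eq field_sum_of_halves
            less_numeral_extra(3) m_def mult.commute mult_2)
      then have "p * (norm a / m + norm b / m) = p * 2" by simp
      then show ?thesis by (simp add: algebra_simps)
    qed
    ultimately show ?thesis by simp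
  qed (use assms in auto)
  show ?thesis using 1 2 by linarith
qed

section \<open>The boundary-layer profile and its differential inequality\<close>

text \<open>
  \<open>bar_P p \<eta>\<close> is the profile of the boundary layer in the stretched distance
  \<open>t = dist / sqrt \<epsilon>\<close> to the boundary; \<open>bar_g\<close> is minus its first and \<open>bar_c\<close> its second
  derivative. For \<open>\<eta> = 0\<close> the slope is \<open>t powr (- 1 / (p - 1)) - t / 3\<close>: the power solves
  \<open>g powr p = - (p - 1) * g'\<close>, so that the gradient term beats the second derivative by the factor
  \<open>p - 1 > 1\<close>, and the linear correction makes the slope vanish at \<open>t = bar_T p\<close>, beyond which the
  barrier is continued by a constant. The \<open>\<eta>\<close>-term adds a logarithmic explosion at \<open>t = 0\<close>, which
  keeps maximum points away from the boundary.
\<close>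

definition bar_T :: "real \<Rightarrow> real" where
  "bar_T p = 3 powr ((p - 1) / p)"

definition bar_P :: "real \<Rightarrow> real \<Rightarrow> real \<Rightarrow> real" where
  "bar_P p \<eta> t = (let a = (p - 2) / (p - 1); T = bar_T p in
     (T powr a - t powr a) / a + (t\<^sup>2 - T\<^sup>2) / 6 + \<eta> * (t / T - 1 - ln (t / T)))"

definition bar_g :: "real \<Rightarrow> real \<Rightarrow> real \<Rightarrow> real" where
  "bar_g p \<eta> t = t powr (- 1 / (p - 1)) - t / 3 + \<eta> * (1 / t - 1 / bar_T p)"

definition bar_c :: "real \<Rightarrow> real \<Rightarrow> real \<Rightarrow> real" where
  "bar_c p \<eta> t = t powr (- p / (p - 1)) / (p - 1) + 1 / 3 + \<eta> / t\<^sup>2"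

lemma bar_T_pos [simp]: "bar_T p > 0"
  by (simp add: bar_T_def)

lemma bar_T_powr: "p > 2 \<Longrightarrow> bar_T p powr (p / (p - 1)) = 3"
  by (simp add: bar_T_def powr_powr)

lemma DERIV_bar_P:
  assumes "p > 2" "t > 0"
  shows "(bar_P p \<eta> has_real_derivative - bar_g p \<eta> t) (at t)"
proof -
  have "(p - 2) / (p - 1) - 1 = - 1 / (p - 1)"
    using assms by (simp add: field_simps)
  moreover have "((\<lambda>t. t powr ((p - 2) / (p - 1))) has_real_derivative
      (p - 2) / (p - 1) * t powr ((p - 2) / (p - 1) - 1)) (at t)"
    using assms by (intro derivative_eq_intros) auto
  ultimately have "((\<lambda>t. (bar_T p powr ((p - 2) / (p - 1)) - t powr ((p - 2) / (p - 1))) / ((p - 2) / (p - 1)))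
      has_real_derivative (0 - (p - 2) / (p - 1) * t powr (- 1 / (p - 1))) / ((p - 2) / (p - 1))) (at t)"
    by (intro DERIV_cdivide DERIV_diff DERIV_const) simp
  then have 1: "((\<lambda>t. (bar_T p powr ((p - 2) / (p - 1)) - t powr ((p - 2) / (p - 1))) / ((p - 2) / (p - 1)))
      has_real_derivative - (t powr (- 1 / (p - 1)))) (at t)"
    using assms by simp
  have 2: "((\<lambda>t. (t\<^sup>2 - (bar_T p)\<^sup>2) / 6) has_real_derivative t / 3) (at t)"
    by (auto intro!: derivative_eq_intros)
  have "((\<lambda>t. t / bar_T p - 1 - ln (t / bar_T p)) has_real_derivative 1 / bar_T p - 1 / t) (at t)"
    using assms bar_T_pos[of p] by (auto intro!: derivative_eq_intros simp: less_imp_neq[symmetric])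
  from DERIV_add[OF DERIV_add[OF 1 2] DERIV_cmult[OF this, of \<eta>]]
  show ?thesis
    unfolding bar_P_def bar_g_def Let_def by (rule DERIV_cong) (simp add: algebra_simps)
qed

lemma DERIV_bar_g:
  assumes "p > 2" "t > 0"
  shows "(bar_g p \<eta> has_real_derivative - bar_c p \<eta> t) (at t)"
proof -
  have *: "- (1 / (p - 1)) - 1 = - (p / (p - 1))"
    using assms by (simp add: field_simps)
  have "((\<lambda>t. t powr (- 1 / (p - 1))) has_real_derivative (- 1 / (p - 1)) * t powr (- 1 / (p - 1) - 1)) (at t)"
    using assms by (auto intro!: derivative_eq_intros)
  then have [derivative_intros]: "((\<lambda>t. t powr (- 1 / (p - 1))) has_real_derivative - (t powr (- p / (p - 1)) / (p - 1))) (at t)"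
    by (simp add: *)
  show ?thesis
    unfolding bar_c_def bar_g_def using assms
    by (auto intro!: derivative_eq_intros simp: field_simps power2_eq_square)
qed

lemma bar_g_nonneg:
  assumes "p > 2" "0 < t" "t \<le> bar_T p" "\<eta> \<ge> 0"
  shows "t powr (- 1 / (p - 1)) - t / 3 \<ge> 0" "bar_g p \<eta> t \<ge> 0"
proof -
  have "t powr (p / (p - 1)) \<le> 3"
    using assms powr_mono2[of "p / (p - 1)" t "bar_T p"] bar_T_powr[of p] by simp
  moreover have "t = t powr (p / (p - 1)) * t powr (- 1 / (p - 1))"
    using assms by (simp add: powr_add[symmetric] add_divide_distrib[symmetric] diff_divide_distrib[symmetric])
  ultimately have "t \<le> 3 * t powr (- 1 / (p - 1))"
    by (metis mult_right_mono powr_ge_zero)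
  then show 1: "t powr (- 1 / (p - 1)) - t / 3 \<ge> 0" by simp
  have "1 / t - 1 / bar_T p \<ge> 0"
    using assms by (simp add: frac_le)
  then show "bar_g p \<eta> t \<ge> 0"
    using 1 assms by (simp add: bar_g_def)
qed

lemma bar_g_nonpos:
  assumes "p > 2" "t \<ge> bar_T p" "\<eta> \<ge> 0"
  shows "bar_g p \<eta> t \<le> 0"
proof -
  have "t > 0" using assms bar_T_pos[of p] by linarith
  have "t powr (p / (p - 1)) \<ge> 3"
    using assms powr_mono2[of "p / (p - 1)" "bar_T p" t] bar_T_powr[of p] bar_T_pos[of p] by simp
  moreover have "t = t powr (p / (p - 1)) * t powr (- 1 / (p - 1))"
    using assms \<open>t > 0\<close> by (simp add: powr_add[symmetric] add_divide_distrib[symmetric] diff_divide_distrib[symmetric])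
  ultimately have "t \<ge> 3 * t powr (- 1 / (p - 1))"
    by (metis mult_right_mono powr_ge_zero)
  moreover have "\<eta> * (1 / t - 1 / bar_T p) \<le> 0"
    using assms by (intro mult_nonneg_nonpos) (auto simp: frac_le)
  ultimately show ?thesis
    by (simp add: bar_g_def)
qed

lemma bar_P_T: "bar_P p \<eta> (bar_T p) = 0"
  using bar_T_pos[of p] by (simp add: bar_P_def Let_def less_imp_neq[symmetric])

lemma bar_P_antimono:
  assumes "p > 2" "0 < s" "s \<le> t" "t \<le> bar_T p" "\<eta> \<ge> 0"
  shows "bar_P p \<eta> t \<le> bar_P p \<eta> s"
proof (rule DERIV_nonpos_imp_nonincreasing[OF \<open>s \<le> t\<close>])
  fix x assume "s \<le> x" "x \<le> t"
  then show "\<exists>y. DERIV (bar_P p \<eta>) x :> y \<and> y \<le> 0"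
    using assms DERIV_bar_P[of p x \<eta>] bar_g_nonneg(2)[of p x \<eta>] by (intro exI[of _ "- bar_g p \<eta> x"]) auto
qed

text \<open>\<open>bar_P\<close> decreases up to \<open>bar_T p\<close> and increases afterwards, so
  its minimum is the value 0 at \<open>bar_T p\<close>. Beyond that point this places the truncated
  barrier below the untruncated profile.\<close>

lemma bar_P_nonneg:
  assumes "p > 2" "0 < t" "\<eta> \<ge> 0"
  shows "bar_P p \<eta> t \<ge> 0"
proof (cases "t \<le> bar_T p")
  case True
  then show ?thesis using bar_P_antimono[of p t "bar_T p" \<eta>] assms bar_P_T by simp
next
  case False
  have "bar_P p \<eta> (bar_T p) \<le> bar_P p \<eta> t"
  proof (rule DERIV_nonneg_imp_nondecreasing[of "bar_T p" t])
    fix x assume "bar_T p \<le> x" "x \<le> t"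
    then show "\<exists>y. DERIV (bar_P p \<eta>) x :> y \<and> 0 \<le> y"
      using assms DERIV_bar_P[of p x \<eta>] bar_g_nonpos[of p x \<eta>] bar_T_pos[of p]
      by (intro exI[of _ "- bar_g p \<eta> x"]) auto
  qed (use False in simp)
  then show ?thesis by (simp add: bar_P_T)
qed

lemma bar_P_at_right_0:
  assumes "p > 2" "\<eta> > 0"
  shows "filterlim (bar_P p \<eta>) at_top (at_right 0)"
proof -
  define a T where "a = (p - 2) / (p - 1)" and "T = bar_T p"
  have "a > 0" "T > 0" using assms by (auto simp: a_def T_def)
  have ln: "filterlim (\<lambda>t. - ln (t::real)) at_top (at_right 0)"
    using ln_at_0 by (subst filterlim_uminus_at_top) simp
  have "filterlim (\<lambda>t. - \<eta> * ln (t / T)) at_top (at_right 0)"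
  proof -
    have "filterlim (\<lambda>t. \<eta> * ln T + \<eta> * (- ln t)) at_top (at_right 0)"
      by (intro filterlim_tendsto_add_at_top[OF tendsto_const]
          filterlim_tendsto_pos_mult_at_top[OF tendsto_const \<open>\<eta> > 0\<close>] ln)
    then show ?thesis
      by (rule filterlim_mono_eventually)
        (use \<open>T > 0\<close> in \<open>auto simp: eventually_at_filter ln_div algebra_simps\<close>)
  qed
  moreover have "((\<lambda>t. (T powr a - t powr a) / a + (t\<^sup>2 - T\<^sup>2) / 6 + \<eta> * (t / T - 1))
      \<longlongrightarrow> (T powr a - 0) / a + (0\<^sup>2 - T\<^sup>2) / 6 + \<eta> * (0 / T - 1)) (at_right 0)"
  proof -
    have "((\<lambda>t::real. t powr a) \<longlongrightarrow> 0) (at_right 0)"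
      using \<open>a > 0\<close> by (intro tendsto_zero_powrI[of _ _ _ a]) (auto simp: tendsto_ident_at eventually_at_filter)
    then show ?thesis
      using \<open>a > 0\<close> \<open>T > 0\<close> by (intro tendsto_intros) auto
  qed
  ultimately have "filterlim (\<lambda>t. ((T powr a - t powr a) / a + (t\<^sup>2 - T\<^sup>2) / 6 + \<eta> * (t / T - 1))
      + - \<eta> * ln (t / T)) at_top (at_right 0)"
    by (rule filterlim_tendsto_add_at_top[rotated])
  moreover have "(\<lambda>t. ((T powr a - t powr a) / a + (t\<^sup>2 - T\<^sup>2) / 6 + \<eta> * (t / T - 1))
      + - \<eta> * ln (t / T)) = bar_P p \<eta>"
    by (auto simp: bar_P_def Let_def a_def T_def algebra_simps)
  ultimately show ?thesis by simp
qed

text \<open>From \<open>s\<^sup>2 <= 3 * s powr a\<close>, with equality at \<open>T\<close>, the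
  height is at most \<open>T powr a * (1 / a - 1 / 2)\<close>. The constant
  \<open>2 powr a / a\<close> then suffices because \<open>T powr a <= 3 powr a\<close>,
  \<open>1 - a / 2 <= exp (- (a / 2))\<close> and \<open>ln (3 / 2) <= 1 / 2\<close>.\<close>

lemma bar_P_0_bound:
  assumes "p > 2" "t > 0"
  defines "a \<equiv> (p - 2) / (p - 1)"
  shows "bar_P p 0 (min t (bar_T p)) \<le> 2 powr a / a"
proof -
  define T where "T = bar_T p"
  define s where "s = min t T"
  have a: "0 < a" "a < 1" using assms by (auto simp: a_def)
  have T: "T > 0" by (simp add: T_def)
  have "p / (p - 1) = 2 - a" using assms by (simp add: a_def field_simps)
  then have T2: "T powr (2 - a) = 3" using bar_T_powr[OF \<open>p > 2\<close>] by (simp add: T_def)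
  have s: "0 < s" "s \<le> T" using assms T by (auto simp: s_def)
  have "s\<^sup>2 = s powr (2 - a) * s powr a"
    using s by (simp add: powr_add[symmetric] powr_numeral)
  also have "\<dots> \<le> 3 * s powr a"
    using powr_mono2[of "2 - a" s T] s a T2 by (intro mult_right_mono) auto
  finally have s2: "s\<^sup>2 \<le> 3 * s powr a" .
  have TT: "T\<^sup>2 = 3 * T powr a"
    using T T2 by (simp add: powr_add[symmetric] powr_numeral flip: T2)
  have "1 / a - 1 / 2 \<ge> 0" using a by (simp add: field_simps)
  then have "s powr a * (1 / a - 1 / 2) \<ge> 0" by simp
  have "bar_P p 0 s = (T powr a - s powr a) / a + (s\<^sup>2 - T\<^sup>2) / 6"
    by (simp add: bar_P_def Let_def a_def T_def)
  also have "\<dots> \<le> (T powr a - s powr a) / a + (3 * s powr a - 3 * T powr a) / 6"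
    using s2 TT by simp
  also have "\<dots> = T powr a * (1 / a - 1 / 2) - s powr a * (1 / a - 1 / 2)"
    by (simp add: diff_divide_distrib right_diff_distrib)
  also have "\<dots> \<le> T powr a * (1 / a - 1 / 2)" using \<open>s powr a * (1 / a - 1 / 2) \<ge> 0\<close> by linarith
  also have "\<dots> = T powr a * (1 - a / 2) / a" using a by (simp add: field_simps)
  also have "\<dots> \<le> 2 powr a / a"
  proof (intro divide_right_mono)
    have "T = 3 powr (1 / (2 - a))"
      unfolding \<open>p / (p - 1) = 2 - a\<close>[symmetric] by (simp add: T_def bar_T_def)
    then have "T powr a = 3 powr (a / (2 - a))" by (simp add: powr_powr)
    also have "\<dots> \<le> 3 powr a" using a by (intro powr_mono) (auto simp: field_simps)
    finally have "T powr a * (1 - a / 2) \<le> 3 powr a * (1 - a / 2)"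
      using a by (intro mult_right_mono) auto
    also have "\<dots> \<le> 3 powr a * exp (- (a / 2))"
      using exp_ge_add_one_self[of "- (a / 2)"] by (intro mult_left_mono) auto
    also have "\<dots> = 2 powr a * exp (a * (ln (3 / 2) - 1 / 2))"
      by (simp add: powr_def exp_add[symmetric] ln_div algebra_simps)
    also have "\<dots> \<le> 2 powr a * 1"
    proof (intro mult_left_mono)
      have "ln (3 / 2 :: real) \<le> 3 / 2 - 1" by (intro ln_le_minus_one) auto
      then show "exp (a * (ln (3 / 2) - 1 / 2)) \<le> 1"
        using a by (simp add: mult_nonneg_nonpos)
    qed auto
    finally show "T powr a * (1 - a / 2) \<le> 2 powr a" by simp
  qed (use a in auto)
  finally show ?thesis by (simp add: s_def T_def)
qed

text \<open>
  With \<open>v = 1 - t powr (p / (p - 1)) / 3\<close> the case \<open>\<eta> = \<kappa> = 0\<close> reads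
  \<open>v powr p + 2 * (1 - v) \<ge> 1 / (p - 1)\<close>. The left-hand side is even at least \<open>2 / p\<close>, and the
  difference pays for the curvature term \<open>\<kappa>\<close> and for \<open>\<eta>\<close> away from \<open>t = 0\<close>; near \<open>t = 0\<close> the
  \<open>\<eta>\<close>-terms are absorbed by convexity, because \<open>p * bar_g powr (p - 1) \<ge> 3 / (2 * t)\<close> there.
\<close>

lemma barrier_inequality:
  assumes "p > 2"
  obtains \<kappa> \<eta>0 where "\<kappa> > 0" "\<eta>0 > 0"
    "\<And>\<eta> t. \<lbrakk>0 < \<eta>; \<eta> < \<eta>0; 0 < t; t \<le> bar_T p\<rbrakk> \<Longrightarrow>
       bar_c p \<eta> t + \<kappa> * bar_g p \<eta> t \<le> bar_g p \<eta> t powr p + 1"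
proof -
  define T where "T = bar_T p"
  \<comment> \<open>\<open>gap\<close> equals \<open>2 / p - 1 / (p - 1)\<close>, the surplus of the
    inequality without \<open>\<eta>\<close> and \<open>\<kappa>\<close>. The choice of
    \<open>\<kappa>\<close> lets the curvature term spend half of it; the other half pays for
    \<open>\<eta>\<close> away from 0.\<close>
  define gap where "gap = (p - 2) / (p * (p - 1))"
  define \<kappa> where "\<kappa> = gap / (2 * T)"
  have T: "T > 0" by (simp add: T_def)
  have "p - 2 < 1 * (p - 1)" by simp
  also have "\<dots> < p * (p - 1)" using assms by (intro mult_strict_right_mono) auto
  finally have gap: "0 < gap" "gap < 1" using assms by (auto simp: gap_def)
  have \<kappa>: "\<kappa> > 0" "\<kappa> * T = gap / 2" using gap T by (auto simp: \<kappa>_def)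
  define v where "v t = 1 - t powr (p / (p - 1)) / 3" for t :: real
  \<comment> \<open>The limit is \<open>p > 2\<close>, while only \<open>3 / 2\<close> is asked: 1
    for the \<open>\<eta>\<close>-term in the second derivative and \<open>1 / 2\<close> for the one
    in the curvature term.\<close>
  have "((\<lambda>t. p * v t powr (p - 1) * (1 - t / T)) \<longlongrightarrow> p * (1 - 0 / 3) powr (p - 1) * (1 - 0 / T)) (at_right 0)"
    unfolding v_def
  proof (intro tendsto_intros)
    show "((\<lambda>t::real. t powr (p / (p - 1))) \<longlongrightarrow> 0) (at_right 0)"
      using assms by (intro tendsto_zero_powrI[of _ _ _ "p / (p - 1)"]) (auto simp: tendsto_ident_at eventually_at_filter)
  qed (use T in auto)
  then have "\<forall>\<^sub>F t in at_right 0. p * v t powr (p - 1) * (1 - t / T) > 3 / 2"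
    by (rule order_tendstoD) (use assms in auto)
  then obtain t0 where "t0 > 0" and t0: "\<And>t. 0 < t \<Longrightarrow> t < t0 \<Longrightarrow> p * v t powr (p - 1) * (1 - t / T) > 3 / 2"
    unfolding eventually_at_right_field by auto
  define a where "a = (p - 2) / (p - 1)"
  have a: "0 < a" using assms by (auto simp: a_def)
  \<comment> \<open>Beyond \<open>t0\<close> half the surplus must cover
    \<open>3 / 2 * \<eta> / t\<^sup>2\<close>; multiplied by \<open>t\<^sup>2\<close> it is
    \<open>gap / 2 * t powr a\<close>, which is smallest at \<open>t0\<close>.\<close>
  define \<eta>0 where "\<eta>0 = gap / 3 * t0 powr a"
  have "\<eta>0 > 0" using gap \<open>t0 > 0\<close> by (simp add: \<eta>0_def)
  show ?thesis
  proof (rule that[OF \<kappa>(1) \<open>\<eta>0 > 0\<close>])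
    fix \<eta> t assume \<eta>: "0 < \<eta>" "\<eta> < \<eta>0" and t: "0 < t" "t \<le> bar_T p"
    define V where "V = v t"
    define A where "A = t powr (- p / (p - 1))"
    define G where "G = t powr (- 1 / (p - 1)) - t / 3"
    define E where "E = 1 / t - 1 / T"
    have "A > 0" using t by (simp add: A_def)
    have E: "E \<ge> 0" using t T by (auto simp: E_def T_def frac_le)
    have G: "G \<ge> 0" using bar_g_nonneg(1)[of p t 0] assms t by (simp add: G_def)
    have tp: "t powr (p / (p - 1)) * A = 1"
      using t assms by (simp add: A_def powr_add[symmetric])
    have AV: "A * (3 * (1 - V)) = 1" using tp by (simp add: V_def v_def mult.commute)
    have tA: "t powr (- 1 / (p - 1)) = t * A"
    proof -
      have "t * A = t powr 1 * t powr (- p / (p - 1))" using t by (simp add: A_def)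
      also have "\<dots> = t powr (1 + - p / (p - 1))" by (simp only: powr_add)
      also have "1 + - p / (p - 1) = - 1 / (p - 1)" using assms by (simp add: field_simps)
      finally show ?thesis by simp
    qed
    have GV: "G = t powr (- 1 / (p - 1)) * V"
    proof -
      have "t * A * V = t * A - t / 3 * (A * (3 * (1 - V)))" by (simp add: algebra_simps)
      then show ?thesis unfolding G_def tA AV by simp
    qed
    have V: "V \<ge> 0"
      using G t unfolding GV by (simp add: zero_le_mult_iff)
    have Gp: "G powr p = A * V powr p"
      using V t by (simp add: GV powr_mult powr_powr A_def)
    have Gp1: "G powr (p - 1) = V powr (p - 1) / t"
    proof -
      have "(t powr (- 1 / (p - 1))) powr (p - 1) = t powr - 1"
        using assms by (simp only: powr_powr) simp
      then show ?thesis
        using V t by (simp only: GV powr_mult powr_neg_one) simp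
    qed
    \<comment> \<open>The coefficient 2 is \<open>3 - 1\<close>, with the 3 of the slope correction
      \<open>t / 3\<close>. As \<open>p\<close> tends to 2, both \<open>2 / p\<close> and
      \<open>1 / (p - 1)\<close> tend to 1, the value of the left side at \<open>V = 1\<close>; a
      smaller coefficient would then fail near \<open>V = 1\<close>.\<close>
    have "V powr p + 2 - 2 * V \<ge> 2 / p"
    proof -
      have "p * V \<le> V powr p + p - 1"
        using powr_ge_tangent_at_1[of V p] V assms by (simp add: algebra_simps)
      then have "2 * V \<le> 2 / p * (V powr p + p - 1)"
        using assms by (simp add: field_simps)
      also have "\<dots> \<le> V powr p + 2 - 2 / p"
      proof -
        have "2 / p * V powr p \<le> 1 * V powr p"
          using assms by (intro mult_right_mono) auto
        then show ?thesis using assms by (simp add: field_simps)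
      qed
      finally show ?thesis by simp
    qed
    moreover have "2 / p = 1 / (p - 1) + gap"
      using assms diff_frac_eq[of p "p - 1" 2 1] by (simp add: gap_def)
    ultimately have "A * (V powr p + 2 * (1 - V)) \<ge> A * (1 / (p - 1) + gap)"
      using \<open>A > 0\<close> by (intro mult_left_mono) auto
    then have base: "G powr p + 2 / 3 \<ge> A / (p - 1) + gap * A"
      using AV by (simp add: Gp algebra_simps)
    have E1: "\<eta> * E \<le> \<eta> / t"
      using \<eta> T by (simp add: E_def field_simps)
    have kE: "\<kappa> * (\<eta> * E) \<le> \<eta> / (2 * t\<^sup>2)"
    proof -
      have "\<kappa> * (\<eta> * E) \<le> \<kappa> * (\<eta> / t)" using E1 \<kappa> by (intro mult_left_mono) auto
      also have "\<dots> = \<kappa> * t * (\<eta> / t\<^sup>2)" using t by (simp add: power2_eq_square)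
      also have "\<dots> \<le> \<kappa> * T * (\<eta> / t\<^sup>2)" using t \<kappa> \<eta> by (intro mult_right_mono mult_left_mono) (auto simp: T_def)
      also have "\<dots> \<le> 1 / 2 * (\<eta> / t\<^sup>2)" unfolding \<kappa> using gap \<eta> by (intro mult_right_mono) auto
      finally show ?thesis by simp
    qed
    have kG: "\<kappa> * G \<le> gap / 2 * A"
    proof -
      have "G \<le> t * A" using t unfolding G_def tA by simp
      also have "\<dots> \<le> T * A" using t \<open>A > 0\<close> by (simp add: T_def)
      finally have "\<kappa> * G \<le> \<kappa> * (T * A)" using \<kappa> by (intro mult_left_mono) auto
      then show ?thesis using \<kappa> by (simp add: mult.assoc[symmetric])
    qed
    have expl: "3 / 2 * \<eta> / t\<^sup>2 \<le> p * G powr (p - 1) * (\<eta> * E) + gap / 2 * A"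
    proof (cases "t < t0")
      case True
      have "p * G powr (p - 1) * (\<eta> * E) = p * V powr (p - 1) * (1 - t / T) * (\<eta> / t\<^sup>2)"
        using t T by (simp add: Gp1 E_def field_simps power2_eq_square)
      moreover have "\<dots> \<ge> 3 / 2 * (\<eta> / t\<^sup>2)"
        using t0[OF t(1) True] \<eta> unfolding V_def by (intro mult_right_mono) auto
      moreover have "gap / 2 * A \<ge> 0" using gap \<open>A > 0\<close> by simp
      ultimately show ?thesis by simp
    next
      case False
      have "t\<^sup>2 * A = t powr a"
      proof -
        have "t\<^sup>2 * A = t powr 2 * t powr (- p / (p - 1))" using t by (simp add: A_def powr_numeral)
        also have "\<dots> = t powr (2 + - p / (p - 1))" by (simp only: powr_add)
        also have "2 + - p / (p - 1) = a" using assms by (simp add: a_def field_simps)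
        finally show ?thesis .
      qed
      then have "gap / 2 * (t\<^sup>2 * A) \<ge> gap / 2 * t0 powr a"
        using False \<open>t0 > 0\<close> gap a by (auto intro!: mult_left_mono powr_mono2)
      then have "3 / 2 * \<eta> \<le> gap / 2 * (t\<^sup>2 * A)"
        using \<eta> by (simp add: \<eta>0_def)
      then have "3 / 2 * \<eta> / t\<^sup>2 \<le> gap / 2 * A"
        using t by (simp add: field_simps)
      moreover have "p * G powr (p - 1) * (\<eta> * E) \<ge> 0" using assms \<eta> E by simp
      ultimately show ?thesis by linarith
    qed
    have g: "bar_g p \<eta> t = G + \<eta> * E" by (simp add: bar_g_def G_def E_def T_def)
    have c: "bar_c p \<eta> t = A / (p - 1) + 1 / 3 + \<eta> / t\<^sup>2" by (simp add: bar_c_def A_def)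
    have "G powr p + p * G powr (p - 1) * (\<eta> * E) \<le> (G + \<eta> * E) powr p"
      using powr_add_ge[of G "\<eta> * E" p] G E \<eta> assms by simp
    moreover have "\<kappa> * bar_g p \<eta> t \<le> gap / 2 * A + \<eta> / (2 * t\<^sup>2)"
      using kE kG by (simp add: g distrib_left)
    moreover have "\<eta> / (2 * t\<^sup>2) = \<eta> / t\<^sup>2 / 2" by simp
    moreover have "3 / 2 * \<eta> / t\<^sup>2 = 3 / 2 * (\<eta> / t\<^sup>2)" by simp
    ultimately show "bar_c p \<eta> t + \<kappa> * bar_g p \<eta> t \<le> bar_g p \<eta> t powr p + 1"
      using base expl unfolding g c by linarith
  qed
qed

subsection \<open>Semiconcavity and interior comparison\<close>

text \<open>The equation on the whole space, with no boundary left to treat. Subsolutions are tested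
  only by paraboloids above \<open>U\<close> everywhere, as a global maximum of the tripled
  functional provides. Supersolutions are tested by local contact, because the doubled variable is
  confined to a ball.\<close>

locale compact_support_solution =
  fixes U F :: "'a::euclidean_space \<Rightarrow> real" and lam p :: real and S :: "'a set"
  assumes p: "p > 1" and lam: "lam > 0" and compact: "compact S"
    and cont_U: "continuous_on UNIV U" and U_nonneg: "\<And>x. U x \<ge> 0" and U_zero: "\<And>x. x \<notin> S \<Longrightarrow> U x = 0"
    and cont_F: "continuous_on UNIV F" and F_nonneg: "\<And>x. F x \<ge> 0" and F_zero: "\<And>x. x \<notin> S \<Longrightarrow> F x = 0"
    and sub: "\<And>x q K. (\<And>h. U (x + h) \<le> U x + q \<bullet> h + K * (norm h)\<^sup>2) \<Longrightarrow> lam * U x + norm q powr p \<le> F x"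
    and super: "\<And>x q K r. r > 0 \<Longrightarrow> (\<And>h. norm h < r \<Longrightarrow> U (x + h) \<ge> U x + q \<bullet> h - K * (norm h)\<^sup>2) \<Longrightarrow>
      lam * U x + norm q powr p \<ge> F x"
begin

lemma bounded_support_fun:
  assumes "continuous_on UNIV G" and "\<And>x. x \<notin> S \<Longrightarrow> G x = (0::real)"
  obtains B where "B > 0" "\<And>x. G x \<le> B"
proof -
  have "bounded (G ` S)"
    using compact assms(1) by (meson compact_continuous_image compact_imp_bounded continuous_on_subset top_greatest)
  then obtain B where "B > 0" "\<And>x. x \<in> S \<Longrightarrow> norm (G x) \<le> B"
    by (auto simp: bounded_pos)
  then show ?thesis
    using assms(2) by (intro that[of B]) (force simp: abs_le_iff)+
qed

lemma F_uniformly_continuous: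
  assumes "e > 0"
  obtains d where "d > 0" "\<And>x y. dist x y < d \<Longrightarrow> \<bar>F x - F y\<bar> < e"
proof -
  define N where "N = (\<Union>x\<in>S. \<Union>y\<in>cball 0 1. {x + y})"
  have "compact N"
    unfolding N_def using compact_sums'[OF compact compact_cball] by simp
  then have "uniformly_continuous_on N F"
    using cont_F compact_uniformly_continuous continuous_on_subset by blast
  then obtain d where "d > 0" and d: "\<And>x y. x \<in> N \<Longrightarrow> y \<in> N \<Longrightarrow> dist x y < d \<Longrightarrow> dist (F x) (F y) < e"
    using \<open>e > 0\<close> unfolding uniformly_continuous_on_def by metis
  have N: "y \<in> N" if "x \<in> S" "dist x y < 1" for x y
  proof -
    have "y = x + (y - x)" "y - x \<in> cball 0 1"
      using that by (auto simp: dist_norm norm_minus_commute)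
    then show ?thesis
      using \<open>x \<in> S\<close> unfolding N_def by blast
  qed
  show ?thesis
  proof (rule that[of "min d 1"])
    fix x y :: 'a assume "dist x y < min d 1"
    then show "\<bar>F x - F y\<bar> < e"
    proof (cases "x \<in> S \<or> y \<in> S")
      case True
      then have "x \<in> N" "y \<in> N"
        using N[of x x] N[of x y] N[of y y] N[of y x] \<open>dist x y < min d 1\<close> by (auto simp: dist_commute)
      then show ?thesis using d \<open>dist x y < min d 1\<close> by (simp add: dist_real_def)
    qed (use F_zero \<open>e > 0\<close> in auto)
  qed (use \<open>d > 0\<close> in auto)
qed

text \<open>Tripling of variables. The penalisation is chosen so that the slope at the middle point \<open>y\<close> is the
  mean of the slopes at \<open>x\<close> and \<open>z\<close>; convexity of the Hamiltonian then cancels the gradient terms.\<close>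

lemma semiconcave:
  assumes F_sc: "\<And>x z. F x + F z - 2 * F ((1 / 2) *\<^sub>R (x + z)) \<le> K * (norm (x - z))\<^sup>2"
  obtains C where "C > 0" "\<And>y h. U (y + h) + U (y - h) - 2 * U y \<le> C * (norm h)\<^sup>2"
proof -
  \<comment> \<open>At a maximum the data contribute at most
    \<open>K * (norm (x - z))\<^sup>2\<close>, while the penalty dominates
    \<open>C / 4 * (norm (x - z))\<^sup>2\<close>; hence the factor 4. The lower bound 1 confines
    the three points.\<close>
  define C where "C = max 1 (4 * K / lam)"
  have C: "C \<ge> 1" "lam * C \<ge> 4 * K"
    using lam by (auto simp: C_def max_def field_simps)
  obtain B where "B > 0" and B: "\<And>x. U x \<le> B"
    using bounded_support_fun[OF cont_U U_zero] by blast
  obtain \<rho> where \<rho>: "\<And>x. x \<in> S \<Longrightarrow> norm x \<le> \<rho>"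
    using compact_imp_bounded[OF compact] by (auto simp: bounded_iff)
  have approx: "U (y0 + h) + U (y0 - h) - 2 * U y0 \<le> C * (norm h)\<^sup>2 + e" if "e > 0" for y0 h e
  proof (rule ccontr)
    assume neg: "\<not> ?thesis"
    obtain d where "d > 0" and d: "\<And>x y. dist x y < d \<Longrightarrow> \<bar>F x - F y\<bar> < lam * e / 2"
      using F_uniformly_continuous[of "lam * e / 2"] \<open>e > 0\<close> lam by auto
    \<comment> \<open>Large enough that \<open>pen x y z < 2 * B\<close> forces the midpoint of
      \<open>x\<close> and \<open>z\<close> to lie within \<open>d\<close> of
      \<open>y\<close>.\<close>
    define A where "A = (2 * B + 1) / d\<^sup>2"
    have "A > 0" using \<open>d > 0\<close> \<open>B > 0\<close> by (simp add: A_def)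
    \<comment> \<open>On symmetric triples the first term vanishes and the second is
      \<open>C * (norm h)\<^sup>2\<close>, so a violation of the claim makes \<open>\<Phi>\<close>
      exceed \<open>e\<close>.\<close>
    define pen where "pen x y z = A / 2 * (norm (x - 2 *\<^sub>R y + z))\<^sup>2 + C / 2 * ((norm (x - y))\<^sup>2 + (norm (z - y))\<^sup>2)" for x y z :: 'a
    define \<Phi> where "\<Phi> = (\<lambda>(x, y, z). U x + U z - 2 * U y - pen x y z)"
    have start: "\<Phi> (y0 + h, y0, y0 - h) > e"
      using neg by (simp add: \<Phi>_def pen_def scaleR_2)
    \<comment> \<open>A positive value of \<open>\<Phi>\<close> puts \<open>x\<close> or
      \<open>z\<close> into \<open>S\<close>, and both are within \<open>4 * B + 1\<close> of
      \<open>y\<close>. Positive values thus occur only in a compact set, and the maximum over it is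
      global.\<close>
    define r where "r = \<rho> + 8 * B + 2"
    have pos: "norm x \<le> r \<and> norm y \<le> r \<and> norm z \<le> r" if "\<Phi> (x, y, z) > 0" for x y z
    proof -
      have pen: "pen x y z < U x + U z"
        using that U_nonneg[of y] by (simp add: \<Phi>_def)
      have "U x + U z \<le> 2 * B" using B[of x] B[of z] by simp
      have "C / 2 * ((norm (x - y))\<^sup>2 + (norm (z - y))\<^sup>2) \<le> pen x y z"
        using \<open>A > 0\<close> by (simp add: pen_def)
      moreover have "1 / 2 * ((norm (x - y))\<^sup>2 + (norm (z - y))\<^sup>2) \<le> C / 2 * ((norm (x - y))\<^sup>2 + (norm (z - y))\<^sup>2)"
        using C by (intro mult_right_mono) auto
      ultimately have "1 / 2 * ((norm (x - y))\<^sup>2 + (norm (z - y))\<^sup>2) \<le> pen x y z"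
        by (rule order.trans[rotated])
      also have "pen x y z \<le> 2 * B"
        using pen \<open>U x + U z \<le> 2 * B\<close> by simp
      finally have "(norm (x - y))\<^sup>2 + (norm (z - y))\<^sup>2 \<le> 4 * B"
        by simp
      then have sq: "(norm (x - y))\<^sup>2 \<le> 4 * B" "(norm (z - y))\<^sup>2 \<le> 4 * B"
        using zero_le_power2[of "norm (x - y)"] zero_le_power2[of "norm (z - y)"] by linarith+
      have le: "s \<le> 4 * B + 1" if "s\<^sup>2 \<le> 4 * B" for s :: real
        using that zero_le_power2[of "s - 1"] \<open>B > 0\<close> by (simp add: power2_eq_square algebra_simps)
      have n: "norm (x - y) \<le> 4 * B + 1" "norm (z - y) \<le> 4 * B + 1"
        using le sq by auto
      have "0 \<le> pen x y z" using C \<open>A > 0\<close> by (auto simp: pen_def)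
      then have "x \<in> S \<or> z \<in> S" using pen U_zero by fastforce
      then have "norm x \<le> \<rho> \<or> norm z \<le> \<rho>" using \<rho> by blast
      have tri: "norm x \<le> norm y + norm (x - y)" "norm z \<le> norm y + norm (z - y)"
        "norm y \<le> norm x + norm (x - y)" "norm y \<le> norm z + norm (z - y)"
        using norm_triangle_ineq2[of x y] norm_triangle_ineq2[of z y]
          norm_triangle_ineq2[of y x] norm_triangle_ineq2[of y z] by (auto simp: norm_minus_commute)
      show ?thesis
        using \<open>norm x \<le> \<rho> \<or> norm z \<le> \<rho>\<close>
      proof
        assume "norm x \<le> \<rho>"
        then show ?thesis using n tri \<open>B > 0\<close> unfolding r_def by - (intro conjI; linarith)
      next
        assume "norm z \<le> \<rho>"
        then show ?thesis using n tri \<open>B > 0\<close> unfolding r_def by - (intro conjI; linarith)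
      qed
    qed
    define D where "D = cball (0::'a) r \<times> cball (0::'a) r \<times> cball (0::'a) r"
    have cont: "continuous_on D \<Phi>"
      unfolding \<Phi>_def case_prod_unfold pen_def
      by (intro continuous_intros continuous_on_compose2[OF cont_U]) auto
    have "(y0 + h, y0, y0 - h) \<in> D"
      using pos[of "y0 + h" y0 "y0 - h"] start \<open>e > 0\<close> by (auto simp: D_def)
    moreover have "compact D"
      unfolding D_def by (intro compact_Times compact_cball)
    ultimately obtain m where m: "m \<in> D" "\<And>m'. m' \<in> D \<Longrightarrow> \<Phi> m' \<le> \<Phi> m"
      using continuous_attains_sup[OF _ _ cont] by blast
    obtain x y z where xyz: "m = (x, y, z)" by (cases m)
    have big: "\<Phi> (x, y, z) > e"
      using m(2)[OF \<open>(y0 + h, y0, y0 - h) \<in> D\<close>] start xyz by simp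
    have max: "\<Phi> (x', y', z') \<le> \<Phi> (x, y, z)" for x' y' z'
      using m(2)[of "(x', y', z')"] pos[of x' y' z'] big \<open>e > 0\<close> xyz
      by (cases "\<Phi> (x', y', z') > 0") (auto simp: D_def)
    define w where "w = x - 2 *\<^sub>R y + z"
    define px pz where "px = A *\<^sub>R w + C *\<^sub>R (x - y)" and "pz = A *\<^sub>R w + C *\<^sub>R (z - y)"
    note norms = power2_norm_eq_inner inner_add_left inner_add_right inner_diff_left inner_diff_right inner_commute
    have "lam * U x + norm px powr p \<le> F x"
    proof (rule sub)
      fix k
      have "U (x + k) \<le> U x + (pen (x + k) y z - pen x y z)"
        using max[of "x + k" y z] by (simp add: \<Phi>_def)
      also have "pen (x + k) y z - pen x y z = px \<bullet> k + (A + C) / 2 * (norm k)\<^sup>2"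
        by (simp add: pen_def px_def w_def norms algebra_simps)
      finally show "U (x + k) \<le> U x + px \<bullet> k + (A + C) / 2 * (norm k)\<^sup>2" by simp
    qed
    moreover have "lam * U z + norm pz powr p \<le> F z"
    proof (rule sub)
      fix k
      have "U (z + k) \<le> U z + (pen x y (z + k) - pen x y z)"
        using max[of x y "z + k"] by (simp add: \<Phi>_def)
      also have "pen x y (z + k) - pen x y z = pz \<bullet> k + (A + C) / 2 * (norm k)\<^sup>2"
        by (simp add: pen_def pz_def w_def norms algebra_simps)
      finally show "U (z + k) \<le> U z + pz \<bullet> k + (A + C) / 2 * (norm k)\<^sup>2" by simp
    qed
    moreover have "lam * U y + norm ((1 / 2) *\<^sub>R (px + pz)) powr p \<ge> F y"
    proof (rule super[of 1])
      fix k
      have "2 * U (y + k) \<ge> 2 * U y + (pen x y z - pen x (y + k) z)"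
        using max[of x "y + k" z] by (simp add: \<Phi>_def)
      moreover have "pen x y z - pen x (y + k) z = (px + pz) \<bullet> k - (2 * A + C) * (norm k)\<^sup>2"
        by (simp add: pen_def px_def pz_def w_def norms algebra_simps)
      moreover have "2 * (((1 / 2) *\<^sub>R (px + pz)) \<bullet> k - (A + C / 2) * (norm k)\<^sup>2)
          = (px + pz) \<bullet> k - (2 * A + C) * (norm k)\<^sup>2"
        by (simp add: algebra_simps)
      ultimately have "2 * (U y + (((1 / 2) *\<^sub>R (px + pz)) \<bullet> k - (A + C / 2) * (norm k)\<^sup>2)) \<le> 2 * U (y + k)"
        by (simp only: distrib_left)
      then show "U (y + k) \<ge> U y + ((1 / 2) *\<^sub>R (px + pz)) \<bullet> k - (A + C / 2) * (norm k)\<^sup>2"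
        by simp
    qed simp
    moreover note norm_midpoint_powr_le[OF p, of px pz]
    ultimately have "lam * U x + lam * U z - 2 * (lam * U y) \<le> F x + F z - 2 * F y"
      by linarith
    then have 1: "lam * (U x + U z - 2 * U y) \<le> F x + F z - 2 * F y"
      by (simp add: algebra_simps)
    have "pen x y z < 2 * B"
      using big \<open>e > 0\<close> U_nonneg[of y] B[of x] B[of z] by (simp add: \<Phi>_def)
    moreover have "A / 2 * (norm w)\<^sup>2 \<le> pen x y z"
      using C by (simp add: pen_def w_def)
    ultimately have "A * (norm w / 2)\<^sup>2 < B + 1 / 2"
      using \<open>B > 0\<close> by (simp add: power_divide)
    also have "B + 1 / 2 < A * d\<^sup>2"
      using \<open>d > 0\<close> \<open>B > 0\<close> by (simp add: A_def)
    finally have "(norm w / 2)\<^sup>2 < d\<^sup>2"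
      using \<open>A > 0\<close> by simp
    then have "norm w / 2 < d"
      using \<open>d > 0\<close> by (intro power2_less_imp_less[of "norm w / 2"]) auto
    moreover have "dist ((1 / 2) *\<^sub>R (x + z)) y = norm w / 2"
    proof -
      have "(1 / 2) *\<^sub>R (x + z) - y = (1 / 2) *\<^sub>R w"
        by (simp add: w_def algebra_simps)
      then show ?thesis by (simp add: dist_norm)
    qed
    ultimately have "\<bar>F ((1 / 2) *\<^sub>R (x + z)) - F y\<bar> < lam * e / 2"
      using d[of "(1 / 2) *\<^sub>R (x + z)" y] by simp
    then have 2: "2 * (F ((1 / 2) *\<^sub>R (x + z)) - F y) < lam * e"
      by (simp only: abs_less_iff) simp
    have "(norm (x - z))\<^sup>2 \<le> 2 * ((norm (x - y))\<^sup>2 + (norm (z - y))\<^sup>2)"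
      using inner_ge_zero[of "(x - y) + (z - y)"] by (simp add: norms algebra_simps)
    then have "(norm (x - z))\<^sup>2 / 2 \<le> (norm (x - y))\<^sup>2 + (norm (z - y))\<^sup>2"
      by simp
    then have "C / 4 * (norm (x - z))\<^sup>2 \<le> C / 2 * ((norm (x - y))\<^sup>2 + (norm (z - y))\<^sup>2)"
      using mult_left_mono[of "(norm (x - z))\<^sup>2 / 2" "(norm (x - y))\<^sup>2 + (norm (z - y))\<^sup>2" "C / 2"] C by simp
    also have "\<dots> \<le> pen x y z" using \<open>A > 0\<close> by (simp add: pen_def)
    finally have "lam * (C / 4 * (norm (x - z))\<^sup>2) \<le> lam * pen x y z" using lam by simp
    moreover have "K * (norm (x - z))\<^sup>2 \<le> lam * C / 4 * (norm (x - z))\<^sup>2"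
      using C by (intro mult_right_mono) auto
    ultimately have 3: "K * (norm (x - z))\<^sup>2 \<le> lam * pen x y z" by simp
    have "lam * e < lam * \<Phi> (x, y, z)" using big lam by simp
    then have "lam * e < lam * (U x + U z - 2 * U y) - lam * pen x y z"
      by (simp add: \<Phi>_def algebra_simps)
    then show False using 1 2 3 F_sc[of x z] by simp
  qed
  show ?thesis
  proof (rule that)
    show "C > 0" using C by simp
    show "U (y + h) + U (y - h) - 2 * U y \<le> C * (norm h)\<^sup>2" for y h
      by (rule field_le_epsilon) (use approx in auto)
  qed
qed

text \<open>
  The doubled variables are \<open>x\<close> and \<open>y = x - v\<close>. At a maximum \<open>U\<close> is touched from below at \<open>y\<close> by a
  paraboloid with slope \<open>q\<close>, hence by semiconcavity from above by one of opening \<open>C\<close> with the same slope.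
  Keeping \<open>v\<close> fixed transfers the latter to \<open>w\<close> at \<open>x\<close>, so no regularity of \<open>w\<close> is needed.
\<close>

lemma interior_comparison:
  fixes w :: "'a \<Rightarrow> real"
  assumes sc: "\<And>y h. U (y + h) + U (y - h) - 2 * U y \<le> C * (norm h)\<^sup>2"
    and compact_D: "compact D" and cont_w: "continuous_on D w"
    and w_sub: "\<And>x q. \<lbrakk>x \<in> D; w x > b; \<And>h. x + h \<in> D \<Longrightarrow> w (x + h) \<le> w x + q \<bullet> h + C / 2 * (norm h)\<^sup>2\<rbrakk>
        \<Longrightarrow> lam * w x + norm q powr p \<le> F x + L"
    and x: "x \<in> D"
  shows "w x - U x \<le> max b (L / lam)"
proof (rule ccontr)
  assume neg: "\<not> ?thesis"
  define M where "M = w x - U x"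
  have M: "M > b" "M > L / lam" using neg by (auto simp: M_def)
  define e where "e = lam * M - L"
  have "e > 0" using M lam by (simp add: e_def field_simps)
  obtain d where "d > 0" and d: "\<And>x y. dist x y < d \<Longrightarrow> \<bar>F x - F y\<bar> < e"
    using F_uniformly_continuous[OF \<open>e > 0\<close>] by metis
  have "compact (w ` D)" using compact_D cont_w compact_continuous_image by blast
  then obtain B where "B > 0" and B: "\<And>x. x \<in> D \<Longrightarrow> norm (w x) \<le> B"
    using compact_imp_bounded by (force simp: bounded_pos)
  define r where "r = min d 1"
  have "r > 0" using \<open>d > 0\<close> by (simp add: r_def)
  \<comment> \<open>With this \<open>A\<close> the maximum has \<open>norm v < r\<close>. Then
    \<open>F\<close> varies by less than \<open>e\<close> between the two points, and
    \<open>v\<close> lies strictly inside the unit ball, so that it can be perturbed to give contact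
    from below.\<close>
  define A where "A = (B + \<bar>M\<bar> + 1) / r\<^sup>2"
  have "A > 0" using \<open>r > 0\<close> \<open>B > 0\<close> by (simp add: A_def add_pos_nonneg)
  define \<Phi> where "\<Phi> = (\<lambda>(x, v). w x - U (x - v) - A * (norm v)\<^sup>2)"
  have "continuous_on (D \<times> cball 0 1) \<Phi>"
    unfolding \<Phi>_def case_prod_unfold
    by (intro continuous_intros continuous_on_compose2[OF cont_U] continuous_on_compose2[OF cont_w]) auto
  moreover have "compact (D \<times> cball (0::'a) 1)" using compact_D by (intro compact_Times compact_cball)
  ultimately obtain m where m: "m \<in> D \<times> cball 0 1" "\<And>m'. m' \<in> D \<times> cball 0 1 \<Longrightarrow> \<Phi> m' \<le> \<Phi> m"
    using continuous_attains_sup[of "D \<times> cball 0 1" \<Phi>] x by (metis SigmaI centre_in_cball empty_iff zero_le_one)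
  obtain x0 v where xv: "m = (x0, v)" by (cases m)
  have x0: "x0 \<in> D" and v: "norm v \<le> 1" using m xv by auto
  have max: "\<Phi> (x', v') \<le> \<Phi> (x0, v)" if "x' \<in> D" "norm v' \<le> 1" for x' v'
    using m(2)[of "(x', v')"] that xv by auto
  define y where "y = x0 - v"
  have "M \<le> \<Phi> (x0, v)" using max[OF x, of 0] by (simp add: \<Phi>_def M_def)
  then have Mle: "M + A * (norm v)\<^sup>2 \<le> w x0 - U y" by (simp add: \<Phi>_def y_def)
  have "A * (norm v)\<^sup>2 < A * r\<^sup>2"
    using Mle B[OF x0] U_nonneg[of y] \<open>r > 0\<close> by (simp add: A_def)
  then have "norm v < r"
    using \<open>A > 0\<close> \<open>r > 0\<close> by (intro power2_less_imp_less[of "norm v"]) auto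
  then have v1: "norm v < 1" "dist x0 y < d" by (auto simp: r_def y_def dist_norm)
  have wM: "w x0 - U y \<ge> M" using Mle \<open>A > 0\<close> zero_le_power2[of "norm v"] mult_nonneg_nonneg[of A "(norm v)\<^sup>2"] by linarith
  define q where "q = (2 * A) *\<^sub>R v"
  have below: "U (y + k) \<ge> U y + q \<bullet> k - A * (norm k)\<^sup>2" if "norm k < 1 - norm v" for k
  proof -
    have "norm (v - k) \<le> 1" using that norm_triangle_ineq4[of v k] by simp
    from max[OF x0 this] have "U (x0 - (v - k)) \<ge> U y + A * (norm v)\<^sup>2 - A * (norm (v - k))\<^sup>2"
      by (simp add: \<Phi>_def y_def)
    moreover have "x0 - (v - k) = y + k" by (simp add: y_def)
    moreover have "A * (norm v)\<^sup>2 - A * (norm (v - k))\<^sup>2 = q \<bullet> k - A * (norm k)\<^sup>2"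
      by (simp add: q_def power2_norm_eq_inner inner_diff_left inner_diff_right inner_commute algebra_simps)
    ultimately show ?thesis by simp
  qed
  have 1: "lam * U y + norm q powr p \<ge> F y"
    by (rule super[of "1 - norm v"]) (use v1 below in auto)
  have above: "U (y + h) \<le> U y + q \<bullet> h + C / 2 * (norm h)\<^sup>2" for h
    by (rule paraboloid_upper_bound_of_semiconcave[OF sc _ below]) (use v1 in auto)
  have 2: "lam * w x0 + norm q powr p \<le> F x0 + L"
  proof (rule w_sub[OF x0])
    \<comment> \<open>The threshold stands in for a boundary condition: the inequality for
      \<open>w\<close> is only demanded where \<open>w\<close> exceeds \<open>b\<close>, and
      \<open>U >= 0\<close> guarantees this at the maximum.\<close>
    show "w x0 > b" using wM M U_nonneg[of y] by linarith
    show "w (x0 + h) \<le> w x0 + q \<bullet> h + C / 2 * (norm h)\<^sup>2" if "x0 + h \<in> D" for h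
    proof -
      have eq: "x0 + h - v = y + h" by (simp add: y_def)
      have "w (x0 + h) - U (x0 + h - v) \<le> w x0 - U y"
        using max[OF that v] by (simp add: \<Phi>_def y_def)
      then show ?thesis using above[of h] unfolding eq by linarith
    qed
  qed
  have "lam * M \<le> lam * (w x0 - U y)" using wM lam by simp
  also have "\<dots> \<le> F x0 - F y + L" using 1 2 by (simp add: algebra_simps)
  also have "\<dots> < e + L" using d[OF v1(2)] by simp
  finally show False by (simp add: e_def)
qed

end

subsection \<open>Comparison with the barrier on a ball\<close>

text \<open>Taylor expansion in Peano's form, with \<open>f'\<close> differentiable at the single
  point \<open>t\<close>. The slack \<open>\<theta>\<close> makes the derivative of the remainder
  nonnegative to the left of 0 and nonpositive to the right, so the remainder has a local maximum
  there.\<close>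

lemma eventually_le_second_order_taylor:
  fixes f f' :: "real \<Rightarrow> real"
  assumes "r > 0" and f: "\<And>x. \<bar>x - t\<bar> < r \<Longrightarrow> (f has_real_derivative f' x) (at x)"
    and f': "(f' has_real_derivative c) (at t)" and "\<theta> > 0"
  shows "\<forall>\<^sub>F k in nhds 0. f (t + k) \<le> f t + f' t * k + (c / 2 + \<theta>) * k\<^sup>2"
proof -
  have "(\<lambda>h. (f' (t + h) - f' t) / h) \<midarrow>0\<rightarrow> c"
    using f' by (simp add: DERIV_def)
  then have "\<forall>\<^sub>F h in at 0. dist ((f' (t + h) - f' t) / h) c < 2 * \<theta>"
    using \<open>\<theta> > 0\<close> by (intro tendstoD) auto
  then obtain d where "d > 0" and d: "\<And>h. h \<noteq> 0 \<Longrightarrow> \<bar>h\<bar> < d \<Longrightarrow> \<bar>(f' (t + h) - f' t) / h - c\<bar> < 2 * \<theta>"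
    unfolding eventually_at by (auto simp: dist_real_def)
  define \<phi> where "\<phi> k = f (t + k) - f t - f' t * k - (c / 2 + \<theta>) * k\<^sup>2" for k
  define \<phi>' where "\<phi>' k = f' (t + k) - f' t - (c + 2 * \<theta>) * k" for k
  have D: "(\<phi> has_real_derivative \<phi>' k) (at k)" if "\<bar>k\<bar> < r" for k
  proof -
    have "(f has_real_derivative f' (t + k)) (at (t + k))"
      using f that by simp
    then have "((\<lambda>k. f (t + k)) has_real_derivative f' (t + k)) (at k)"
      by (simp add: DERIV_shift add.commute)
    then show ?thesis
      unfolding \<phi>_def \<phi>'_def by (auto intro!: derivative_eq_intros simp: algebra_simps)
  qed
  have neg: "\<phi>' k \<le> 0" if "0 < k" "k < d" for k
    using d[of k] that by (simp add: \<phi>'_def abs_less_iff field_simps)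
  have pos: "\<phi>' k \<ge> 0" if "k < 0" "- d < k" for k
    using d[of k] that by (simp add: \<phi>'_def abs_less_iff field_simps)
  have z: "\<phi>' 0 = 0" by (simp add: \<phi>'_def)
  have le0: "\<phi> k \<le> 0" if "\<bar>k\<bar> < min r d" for k
  proof (cases "k \<ge> 0")
    case True
    have "\<phi> k \<le> \<phi> 0"
    proof (rule DERIV_nonpos_imp_nonincreasing[OF True])
      fix x assume "0 \<le> x" "x \<le> k"
      then show "\<exists>y. DERIV \<phi> x :> y \<and> y \<le> 0"
        using D[of x] neg[of x] z that by (cases "x = 0") (auto intro!: exI[of _ "\<phi>' x"])
    qed
    then show ?thesis by (simp add: \<phi>_def)
  next
    case False
    have "\<phi> k \<le> \<phi> 0"
    proof (rule DERIV_nonneg_imp_nondecreasing[of k 0])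
      fix x assume "k \<le> x" "x \<le> 0"
      then show "\<exists>y. DERIV \<phi> x :> y \<and> 0 \<le> y"
        using D[of x] pos[of x] z that by (cases "x = 0") (auto intro!: exI[of _ "\<phi>' x"])
    qed (use False in simp)
    then show ?thesis by (simp add: \<phi>_def)
  qed
  show ?thesis
    unfolding eventually_nhds_metric
  proof (intro exI[of _ "min r d"] conjI allI impI)
    fix k :: real assume "dist k 0 < min r d"
    then show "f (t + k) \<le> f t + f' t * k + (c / 2 + \<theta>) * k\<^sup>2"
      using le0[of k] by (simp add: \<phi>_def)
  qed (use \<open>r > 0\<close> \<open>d > 0\<close> in auto)
qed

text \<open>At a positive maximum of \<open>w\<close> minus the barrier, \<open>lam * w\<close>
  exceeds \<open>D\<close>, whereas the profile inequality forces it to be at most \<open>D\<close>.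
  The bound \<open>B\<close> locates that maximum inside the ball, and the estimate is independent
  of it.\<close>

lemma state_constraint_ball_bound:
  fixes w :: "'a::euclidean_space \<Rightarrow> real"
  assumes p: "p > 2" and lam: "lam > 0" and \<epsilon>: "\<epsilon> > 0" and "R > 0"
    and sol: "SC_solution lam p \<epsilon> \<Omega> f w"
    and ball: "ball y0 R \<subseteq> \<Omega>" and f0: "\<And>x. x \<in> ball y0 R \<Longrightarrow> f x = 0"
    and cont: "continuous_on (ball y0 R) w" and B: "\<And>x. x \<in> ball y0 R \<Longrightarrow> w x \<le> B"
    and "\<eta>0 > 0"
    and barrier: "\<And>\<eta> t. \<lbrakk>0 < \<eta>; \<eta> < \<eta>0; 0 < t; t \<le> bar_T p\<rbrakk> \<Longrightarrow>
       bar_c p \<eta> t + \<kappa> * bar_g p \<eta> t \<le> bar_g p \<eta> t powr p + 1"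
    and small: "bar_T p * sqrt \<epsilon> \<le> R / 2" "2 * DIM('a) * sqrt \<epsilon> / R \<le> \<kappa>"
    and x1: "x1 \<in> ball y0 R"
  defines "a \<equiv> (p - 2) / (p - 1)"
  shows "w x1 \<le> (1 / lam + 2 powr a / a) * \<epsilon> powr (1 - a / 2)"
proof -
  define \<delta> where "\<delta> = sqrt \<epsilon>"
  define T where "T = bar_T p"
  define D where "D = \<epsilon> powr (1 - a / 2)"
  define n where "n = real DIM('a)"
  have \<delta>: "\<delta> > 0" "\<delta>\<^sup>2 = \<epsilon>" using \<epsilon> by (auto simp: \<delta>_def)
  have "T > 0" "D > 0" using \<epsilon> by (auto simp: T_def D_def)
  have D\<delta>: "(D / \<delta>) powr p = D"
  proof -
    have "D / \<delta> = \<epsilon> powr (1 - a / 2 - 1 / 2)"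
      unfolding powr_diff[of \<epsilon> "1 - a / 2"] using \<epsilon> by (simp add: D_def \<delta>_def powr_half_sqrt)
    then have "(D / \<delta>) powr p = \<epsilon> powr ((1 - a / 2 - 1 / 2) * p)" by (simp add: powr_powr)
    also have "(1 - a / 2 - 1 / 2) * p = 1 - a / 2"
      using p by (simp add: a_def field_simps)
    finally show ?thesis by (simp add: D_def)
  qed
  define s where "s x = norm (x - y0)" for x
  define t where "t x = (R - s x) / \<delta>" for x
  have s: "s x < R" "s x \<ge> 0" "t x > 0" if "x \<in> ball y0 R" for x
    using that \<delta> by (auto simp: s_def t_def dist_norm norm_minus_commute)
  have cont_s: "continuous_on X s" for X unfolding s_def by (intro continuous_intros)
  have cont_t: "continuous_on X t" for X unfolding t_def using \<delta> by (intro continuous_intros cont_s) auto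
  define W where "W \<eta> t = bar_P p \<eta> (min t T)" for \<eta> t
  have W_antimono: "W \<eta> y \<le> W \<eta> x" if "0 < x" "x \<le> y" "\<eta> > 0" for \<eta> x y
    unfolding W_def using that \<open>T > 0\<close> p by (intro bar_P_antimono) (auto simp: T_def)
  have W_nonneg: "W \<eta> x \<ge> 0" if "0 < x" "\<eta> > 0" for \<eta> x
    unfolding W_def using that \<open>T > 0\<close> p by (intro bar_P_nonneg) auto
  \<comment> \<open>The second derivative of \<open>W\<close> jumps at \<open>T\<close>, but
    \<open>W\<close> stays below \<open>bar_P\<close> and agrees with it up to \<open>T\<close>, so
    \<open>bar_P\<close> supplies the test function there too.\<close>
  have W_le: "W \<eta> x \<le> bar_P p \<eta> x" if "0 < x" "\<eta> > 0" for \<eta> x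
    unfolding W_def using bar_P_nonneg[of p x \<eta>] that p bar_P_T[of p \<eta>]
    by (cases "x \<le> T") (auto simp: T_def min_def)
  have cont_P: "continuous_on {0<..} (bar_P p \<eta>)" for \<eta>
    using DERIV_bar_P[OF p] by (intro continuous_at_imp_continuous_on ballI) (auto intro: DERIV_isCont)
  have main: "w x1 \<le> D * (1 / lam + W \<eta> (t x1))" if \<eta>: "0 < \<eta>" "\<eta> < \<eta>0" for \<eta>
  proof (rule ccontr)
    assume neg: "\<not> ?thesis"
    define \<Phi> where "\<Phi> x = w x - D * (1 / lam + W \<eta> (t x))" for x
    have "\<Phi> x1 > 0" using neg by (simp add: \<Phi>_def)
    have cont\<Phi>: "continuous_on (ball y0 R) \<Phi>"
      unfolding \<Phi>_def W_def using s(3) \<open>T > 0\<close>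
      by (intro continuous_intros cont continuous_on_compose2[OF cont_P] cont_t) auto
    have "\<forall>\<^sub>F t in at_right 0. bar_P p \<eta> t > B / D"
      using bar_P_at_right_0[OF p \<eta>(1)] by (simp add: filterlim_at_top_dense)
    then obtain \<tau> where "\<tau> > 0" and \<tau>: "\<And>t. 0 < t \<Longrightarrow> t < \<tau> \<Longrightarrow> bar_P p \<eta> t > B / D"
      unfolding eventually_at_right_field by auto
    \<comment> \<open>At stretched distance below \<open>\<tau>'\<close> the barrier exceeds
      \<open>B\<close>, so a maximum over the smaller closed ball is one over the whole ball. The
      cap \<open>T\<close> makes \<open>W\<close> equal to \<open>bar_P\<close> there, and the cap
      \<open>t x1\<close> keeps \<open>x1\<close> in the smaller ball.\<close>
    define \<tau>' where "\<tau>' = min (min \<tau> T) (t x1)"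
    have \<tau>': "\<tau>' > 0" "\<tau>' \<le> t x1" using \<open>\<tau> > 0\<close> \<open>T > 0\<close> s(3)[OF x1] by (auto simp: \<tau>'_def)
    define R' where "R' = R - \<delta> * \<tau>'"
    have "R' < R" using \<tau>' \<delta> by (simp add: R'_def)
    then have sub: "cball y0 R' \<subseteq> ball y0 R" by auto
    have x1': "x1 \<in> cball y0 R'"
    proof -
      have "\<delta> * \<tau>' \<le> \<delta> * t x1" using \<tau>' \<delta> by (intro mult_left_mono) auto
      then show ?thesis using \<delta> by (simp add: R'_def t_def s_def dist_norm norm_minus_commute)
    qed
    obtain x0 where x0: "x0 \<in> cball y0 R'" "\<And>x. x \<in> cball y0 R' \<Longrightarrow> \<Phi> x \<le> \<Phi> x0"
      using continuous_attains_sup[of "cball y0 R'" \<Phi>] continuous_on_subset[OF cont\<Phi> sub] x1'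
      by (metis compact_cball empty_iff)
    have \<Phi>0: "\<Phi> x0 > 0" using x0(2)[OF x1'] \<open>\<Phi> x1 > 0\<close> by simp
    have max: "\<Phi> x \<le> \<Phi> x0" if "x \<in> ball y0 R" for x
    proof (cases "x \<in> cball y0 R'")
      case False
      then have "R' < s x" by (simp add: s_def dist_norm norm_minus_commute)
      then have "t x < \<tau>'" using \<delta> by (simp add: t_def R'_def field_simps)
      then have "bar_P p \<eta> (t x) > B / D" "t x \<le> T" using \<tau> s(3)[OF that] by (auto simp: \<tau>'_def)
      then have "D * W \<eta> (t x) > B" using \<open>D > 0\<close> by (simp add: W_def field_simps)
      moreover have "D * (1 / lam) > 0" using \<open>D > 0\<close> lam by simp
      ultimately have "\<Phi> x < 0" unfolding \<Phi>_def distrib_left using B[OF that] by linarith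
      then show ?thesis using \<Phi>0 by simp
    qed (use x0 in auto)
    have x0R: "x0 \<in> ball y0 R" using x0(1) sub by blast
    then have x0\<Omega>: "x0 \<in> \<Omega>" using ball by blast
    have touch: "w x \<le> w x0 + D * (W \<eta> (t x) - W \<eta> (t x0))" if "x \<in> ball y0 R" for x
      using max[OF that] by (simp add: \<Phi>_def algebra_simps)
    have w0: "lam * w x0 > D"
    proof -
      have "w x0 > D * (1 / lam)"
        using \<Phi>0 mult_nonneg_nonneg[of D "W \<eta> (t x0)"] W_nonneg[OF s(3)[OF x0R] \<eta>(1)] \<open>D > 0\<close>
        unfolding \<Phi>_def distrib_left by linarith
      then show ?thesis using lam by (simp add: field_simps)
    qed
    have ev_ball: "\<forall>\<^sub>F x in nhds x0. x \<in> ball y0 R"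
      using x0R by (intro eventually_nhds_in_open) auto
    have tend_t: "(t \<longlongrightarrow> t x0) (nhds x0)"
      using cont_t[of UNIV] by (simp add: continuous_on_eq_continuous_at isCont_def tendsto_at_iff_tendsto_nhds)
    show False
    proof (cases "t x0 > T")
      case True
      \<comment> \<open>Here the barrier is locally constant, and a constant test function already
        gives \<open>lam * w x0 <= 0\<close>.\<close>
      then have "\<forall>\<^sub>F x in nhds x0. t x > T"
        using tend_t by (rule order_tendstoD[rotated])
      then have "\<forall>\<^sub>F x in nhds x0. x \<in> \<Omega> \<longrightarrow> w x \<le> w x0 + 0 \<bullet> (x - x0) + 0 * ((x - x0) \<bullet> (x - x0)) + 0 * (0 \<bullet> (x - x0))\<^sup>2"
        using ev_ball
      proof eventually_elim
        case (elim x)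
        then show ?case using touch[of x] True by (simp add: W_def)
      qed
      from subsolution_quad[OF sol x0\<Omega> this] f0[OF x0R] w0 \<open>D > 0\<close> show False by simp
    next
      case False
      define t0 s0 where "t0 = t x0" and "s0 = s x0"
      have t0: "0 < t0" "t0 \<le> T" using False s(3)[OF x0R] by (auto simp: t0_def)
      have s0t0: "s0 = R - \<delta> * t0" using \<delta> by (simp add: s0_def t0_def t_def)
      have "\<delta> * t0 \<le> R / 2"
      proof -
        have "\<delta> * t0 \<le> \<delta> * T" using \<delta> t0 by simp
        then show ?thesis using small(1) by (simp add: \<delta>_def T_def mult.commute)
      qed
      then have s0: "s0 \<ge> R / 2" "s0 > 0" using s0t0 \<open>R > 0\<close> by auto
      define \<nu> where "\<nu> = (1 / s0) *\<^sub>R (x0 - y0)"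
      have \<nu>: "norm \<nu> = 1" using s0 by (simp add: \<nu>_def s0_def s_def)
      \<comment> \<open>A quadratic majorant of the increment of \<open>s\<close>, exact to first
        order, from \<open>(s x - s0)\<^sup>2 >= 0\<close>. Its Laplacian is \<open>n / s0\<close>
        instead of the exact \<open>(n - 1) / s0\<close>, an excess that \<open>\<kappa>\<close>
        absorbs.\<close>
      define \<sigma> where "\<sigma> x = \<nu> \<bullet> (x - x0) + ((x - x0) \<bullet> (x - x0)) / (2 * s0)" for x
      have s_le: "s x \<le> s0 + \<sigma> x" for x
      proof -
        have "2 * s0 * (s x - s0) \<le> (s x)\<^sup>2 - s0\<^sup>2"
          using zero_le_power2[of "s x - s0"] by (simp add: power2_eq_square algebra_simps)
        also have "(s x)\<^sup>2 - s0\<^sup>2 = 2 * ((x0 - y0) \<bullet> (x - x0)) + (x - x0) \<bullet> (x - x0)"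
          by (simp add: s_def s0_def power2_norm_eq_inner inner_diff_left inner_diff_right inner_commute algebra_simps)
        also have "\<dots> = 2 * s0 * \<sigma> x"
          using s0 by (simp add: \<sigma>_def \<nu>_def distrib_left)
        finally show ?thesis using s0 by simp
      qed
      define g c where "g = bar_g p \<eta> t0" and "c = bar_c p \<eta> t0"
      have "g \<ge> 0" using bar_g_nonneg(2)[of p t0 \<eta>] p t0 \<eta> by (simp add: g_def T_def)
      have "c \<ge> 0" using p t0 \<eta> by (simp add: c_def bar_c_def)
      have tend_\<sigma>: "(\<sigma> \<longlongrightarrow> 0) (nhds x0)"
      proof -
        have "continuous_on UNIV \<sigma>" unfolding \<sigma>_def using s0 by (intro continuous_intros) auto
        moreover have "\<sigma> x0 = 0" by (simp add: \<sigma>_def)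
        ultimately show ?thesis
          by (simp add: continuous_on_eq_continuous_at isCont_def tendsto_at_iff_tendsto_nhds)
             (metis tendsto_at_iff_tendsto_nhds)
      qed
      have tend_k: "((\<lambda>x. - \<sigma> x / \<delta>) \<longlongrightarrow> 0) (nhds x0)"
        using tendsto_divide[OF tendsto_minus[OF tend_\<sigma>] tendsto_const, of \<delta>] \<delta> by simp
      \<comment> \<open>\<open>\<theta>\<close> is the slack of the second-order expansion and also
        absorbs the higher-order terms of \<open>(\<sigma> x)\<^sup>2\<close>; it is sent to 0
        afterwards.\<close>
      have key: "lam * w x0 + norm ((D * g / \<delta>) *\<^sub>R \<nu>) powr p
          - \<epsilon> * (2 * n * (D * (g / (2 * s0 * \<delta>) + (c / 2 + \<theta>) / \<delta>\<^sup>2 * \<theta>)) + 2 * (D * (c / 2 + \<theta>) / \<delta>\<^sup>2) * (norm \<nu>)\<^sup>2) \<le> 0"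
        if "\<theta> > 0" for \<theta>
      proof -
        have "\<forall>\<^sub>F k in nhds 0. bar_P p \<eta> (t0 + k) \<le> bar_P p \<eta> t0 + - g * k + (c / 2 + \<theta>) * k\<^sup>2"
        proof -
          have "((\<lambda>x. - bar_g p \<eta> x) has_real_derivative c) (at t0)"
            using DERIV_minus[OF DERIV_bar_g[OF p t0(1), of \<eta>]] by (simp add: c_def)
          moreover have "(bar_P p \<eta> has_real_derivative - bar_g p \<eta> x) (at x)" if "\<bar>x - t0\<bar> < t0" for x
            using that by (intro DERIV_bar_P[OF p]) auto
          ultimately show ?thesis
            unfolding g_def using eventually_le_second_order_taylor[of t0 t0 "bar_P p \<eta>" "\<lambda>x. - bar_g p \<eta> x" c \<theta>] t0 \<open>\<theta> > 0\<close>
            by simp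
        qed
        then have 1: "\<forall>\<^sub>F x in nhds x0. bar_P p \<eta> (t0 + - \<sigma> x / \<delta>) \<le> bar_P p \<eta> t0 + - g * (- \<sigma> x / \<delta>) + (c / 2 + \<theta>) * (- \<sigma> x / \<delta>)\<^sup>2"
          using tend_k by (rule eventually_compose_filterlim)
        have 2: "\<forall>\<^sub>F x in nhds x0. - t0 < - \<sigma> x / \<delta>"
          using tend_k t0 by (intro order_tendstoD) auto
        have 3: "\<forall>\<^sub>F x in nhds x0. (\<sigma> x)\<^sup>2 \<le> (\<nu> \<bullet> (x - x0))\<^sup>2 + \<theta> * ((x - x0) \<bullet> (x - x0))"
        proof -
          have "((\<lambda>x. (\<nu> \<bullet> (x - x0)) / s0 + ((x - x0) \<bullet> (x - x0)) / (4 * s0\<^sup>2)) \<longlongrightarrow>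
              (\<nu> \<bullet> (x0 - x0)) / s0 + ((x0 - x0) \<bullet> (x0 - x0)) / (4 * s0\<^sup>2)) (nhds x0)"
            using s0 by (intro tendsto_intros filterlim_ident) auto
          then have "\<forall>\<^sub>F x in nhds x0. (\<nu> \<bullet> (x - x0)) / s0 + ((x - x0) \<bullet> (x - x0)) / (4 * s0\<^sup>2) < \<theta>"
            using \<open>\<theta> > 0\<close> by (intro order_tendstoD) auto
          then show ?thesis
          proof eventually_elim
            case (elim x)
            have "(\<sigma> x)\<^sup>2 = (\<nu> \<bullet> (x - x0))\<^sup>2 + ((\<nu> \<bullet> (x - x0)) / s0 + ((x - x0) \<bullet> (x - x0)) / (4 * s0\<^sup>2)) * ((x - x0) \<bullet> (x - x0))"
              using s0 by (simp add: \<sigma>_def power2_eq_square field_simps)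
            also have "\<dots> \<le> (\<nu> \<bullet> (x - x0))\<^sup>2 + \<theta> * ((x - x0) \<bullet> (x - x0))"
              using elim by (intro add_left_mono mult_right_mono) auto
            finally show ?case .
          qed
        qed
        have "\<forall>\<^sub>F x in nhds x0. x \<in> \<Omega> \<longrightarrow> w x \<le> w x0 + ((D * g / \<delta>) *\<^sub>R \<nu>) \<bullet> (x - x0)
            + D * (g / (2 * s0 * \<delta>) + (c / 2 + \<theta>) / \<delta>\<^sup>2 * \<theta>) * ((x - x0) \<bullet> (x - x0))
            + D * (c / 2 + \<theta>) / \<delta>\<^sup>2 * (\<nu> \<bullet> (x - x0))\<^sup>2"
          using 1 2 3 ev_ball
        proof eventually_elim
          case (elim x)
          have "t0 + - \<sigma> x / \<delta> = (R - (s0 + \<sigma> x)) / \<delta>"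
            using \<delta>(1) by (simp add: s0t0 field_simps)
          also have "\<dots> \<le> t x"
            unfolding t_def using s_le[of x] \<delta> by (intro divide_right_mono) auto
          finally have "W \<eta> (t x) \<le> W \<eta> (t0 + - \<sigma> x / \<delta>)"
            using elim(2) \<eta> by (intro W_antimono) auto
          also have "\<dots> \<le> bar_P p \<eta> (t0 + - \<sigma> x / \<delta>)"
            using elim(2) \<eta> by (intro W_le) auto
          also have "\<dots> \<le> bar_P p \<eta> t0 + g * \<sigma> x / \<delta> + (c / 2 + \<theta>) / \<delta>\<^sup>2 * (\<sigma> x)\<^sup>2"
            using elim(1) by (simp add: power_divide)
          also have "bar_P p \<eta> t0 = W \<eta> t0" using t0 by (simp add: W_def)
          also have "(c / 2 + \<theta>) / \<delta>\<^sup>2 * (\<sigma> x)\<^sup>2 \<le> (c / 2 + \<theta>) / \<delta>\<^sup>2 * ((\<nu> \<bullet> (x - x0))\<^sup>2 + \<theta> * ((x - x0) \<bullet> (x - x0)))"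
            using elim(3) \<open>c \<ge> 0\<close> \<open>\<theta> > 0\<close> by (intro mult_left_mono) auto
          finally have "W \<eta> (t x) - W \<eta> t0 \<le> g * \<sigma> x / \<delta> + (c / 2 + \<theta>) / \<delta>\<^sup>2 * ((\<nu> \<bullet> (x - x0))\<^sup>2 + \<theta> * ((x - x0) \<bullet> (x - x0)))"
            by simp
          then have "D * (W \<eta> (t x) - W \<eta> t0) \<le> D * (g * \<sigma> x / \<delta> + (c / 2 + \<theta>) / \<delta>\<^sup>2 * ((\<nu> \<bullet> (x - x0))\<^sup>2 + \<theta> * ((x - x0) \<bullet> (x - x0))))"
            using \<open>D > 0\<close> by (intro mult_left_mono) auto
          also have "\<dots> = ((D * g / \<delta>) *\<^sub>R \<nu>) \<bullet> (x - x0)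
            + D * (g / (2 * s0 * \<delta>) + (c / 2 + \<theta>) / \<delta>\<^sup>2 * \<theta>) * ((x - x0) \<bullet> (x - x0))
            + D * (c / 2 + \<theta>) / \<delta>\<^sup>2 * (\<nu> \<bullet> (x - x0))\<^sup>2"
          proof -
            define M N where "M = \<nu> \<bullet> (x - x0)" and "N = (x - x0) \<bullet> (x - x0)"
            have "\<sigma> x = M + N / (2 * s0)" "((D * g / \<delta>) *\<^sub>R \<nu>) \<bullet> (x - x0) = D * g / \<delta> * M"
              by (simp_all add: \<sigma>_def M_def N_def)
            then show ?thesis
              unfolding M_def[symmetric] N_def[symmetric] by (simp add: algebra_simps add_divide_distrib)
          qed
          finally show ?case using touch[of x] elim(4) by (simp add: t0_def)
        qed
        from subsolution_quad[OF sol x0\<Omega> this] f0[OF x0R] show ?thesis by (simp add: n_def)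
      qed
      have np: "norm ((D * g / \<delta>) *\<^sub>R \<nu>) powr p = D * g powr p"
      proof -
        have "norm ((D * g / \<delta>) *\<^sub>R \<nu>) = (D / \<delta>) * g"
          using \<open>g \<ge> 0\<close> \<open>D > 0\<close> \<delta> by (simp add: \<nu>)
        then show ?thesis using D\<delta> by (metis powr_mult)
      qed
      have lim: "((\<lambda>\<theta>. lam * w x0 + D * g powr p
          - \<epsilon> * (2 * n * (D * (g / (2 * s0 * \<delta>) + (c / 2 + \<theta>) / \<delta>\<^sup>2 * \<theta>)) + 2 * (D * (c / 2 + \<theta>) / \<delta>\<^sup>2)))
        \<longlongrightarrow> lam * w x0 + D * g powr p
          - \<epsilon> * (2 * n * (D * (g / (2 * s0 * \<delta>) + (c / 2 + 0) / \<delta>\<^sup>2 * 0)) + 2 * (D * (c / 2 + 0) / \<delta>\<^sup>2))) (at_right 0)"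
        using \<delta> by (intro tendsto_intros) auto
      have "lam * w x0 + D * g powr p
          - \<epsilon> * (2 * n * (D * (g / (2 * s0 * \<delta>) + (c / 2 + 0) / \<delta>\<^sup>2 * 0)) + 2 * (D * (c / 2 + 0) / \<delta>\<^sup>2)) \<le> 0"
      proof (rule tendsto_upperbound[OF lim])
        show "\<forall>\<^sub>F \<theta> in at_right 0. lam * w x0 + D * g powr p
          - \<epsilon> * (2 * n * (D * (g / (2 * s0 * \<delta>) + (c / 2 + \<theta>) / \<delta>\<^sup>2 * \<theta>)) + 2 * (D * (c / 2 + \<theta>) / \<delta>\<^sup>2)) \<le> 0"
          using eventually_at_right_less[of 0] by eventually_elim (use key np \<nu> in simp)
      qed simp
      also have "\<epsilon> * (2 * n * (D * (g / (2 * s0 * \<delta>) + (c / 2 + 0) / \<delta>\<^sup>2 * 0)) + 2 * (D * (c / 2 + 0) / \<delta>\<^sup>2))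
          = D * (c + n * \<delta> / s0 * g)"
        using \<delta>(1) s0 unfolding \<delta>(2)[symmetric] by (simp add: field_simps power2_eq_square)
      finally have "lam * w x0 \<le> D * (c + n * \<delta> / s0 * g - g powr p)"
        by (simp add: algebra_simps)
      also have "\<dots> \<le> D * 1"
      proof (intro mult_left_mono)
        \<comment> \<open>The contact point lies in the layer, hence at distance at least
          \<open>R / 2\<close> from the centre, where the curvature coefficient is at most
          \<open>\<kappa>\<close>.\<close>
        have "n * \<delta> / s0 \<le> n * \<delta> / (R / 2)"
          using s0 \<open>R > 0\<close> \<delta> by (intro divide_left_mono) (auto simp: n_def)
        also have "\<dots> \<le> \<kappa>" using small(2) by (simp add: n_def \<delta>_def mult.commute mult.left_commute)
        finally have "n * \<delta> / s0 * g \<le> \<kappa> * g" using \<open>g \<ge> 0\<close> by (intro mult_right_mono)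
        then show "c + n * \<delta> / s0 * g - g powr p \<le> 1"
          using barrier[OF \<eta> t0(1)] t0 by (simp add: g_def c_def T_def)
      qed (use \<open>D > 0\<close> in auto)
      finally show False using w0 by simp
    qed
  qed
  have "((\<lambda>\<eta>. D * (1 / lam + W \<eta> (t x1))) \<longlongrightarrow> D * (1 / lam + W 0 (t x1))) (at_right 0)"
    unfolding W_def bar_P_def Let_def by (intro tendsto_intros)
  moreover have "\<forall>\<^sub>F \<eta> in at_right 0. w x1 \<le> D * (1 / lam + W \<eta> (t x1))"
    using eventually_at_right_less[of 0] eventually_at_right_real[OF \<open>\<eta>0 > 0\<close>]
    by eventually_elim (use main in auto)
  ultimately have "w x1 \<le> D * (1 / lam + W 0 (t x1))"
    by (rule tendsto_lowerbound) simp
  also have "\<dots> \<le> D * (1 / lam + 2 powr a / a)"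
    using bar_P_0_bound[OF p s(3)[OF x1]] \<open>D > 0\<close> by (intro mult_left_mono) (auto simp: W_def T_def a_def)
  finally show ?thesis by (simp add: D_def mult.commute)
qed

subsection \<open>The uniform interior ball condition\<close>

lemma frechet_derivative_eq_grad:
  assumes "f differentiable at x"
  shows "frechet_derivative f (at x) h = grad f x \<bullet> h"
proof -
  have lin: "linear (frechet_derivative f (at x))"
    using assms by (rule linear_frechet_derivative)
  have "frechet_derivative f (at x) h = frechet_derivative f (at x) (\<Sum>b\<in>Basis. (h \<bullet> b) *\<^sub>R b)"
    by (simp add: euclidean_representation)
  also have "\<dots> = (\<Sum>b\<in>Basis. (h \<bullet> b) * frechet_derivative f (at x) b)"
    using lin by (simp add: linear_sum linear_scale)
  also have "\<dots> = grad f x \<bullet> h"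
    unfolding grad_def pderiv_dir_def inner_sum_left by (intro sum.cong) (auto simp: inner_commute)
  finally show ?thesis .
qed

lemma has_derivative_grad:
  assumes "C1_fun f"
  shows "(f has_derivative (\<lambda>h. grad f x \<bullet> h)) (at x)"
proof -
  have d: "f differentiable at x" using assms by (simp add: C1_fun_def)
  then have "(f has_derivative frechet_derivative f (at x)) (at x)"
    by (simp add: frechet_derivative_works)
  moreover have "frechet_derivative f (at x) = (\<lambda>h. grad f x \<bullet> h)"
    using frechet_derivative_eq_grad[OF d] by blast
  ultimately show ?thesis by simp
qed

lemma continuous_on_grad: "C1_fun f \<Longrightarrow> continuous_on X (grad f)"
  unfolding grad_def C1_fun_def
  by (intro continuous_intros) (auto intro: continuous_on_subset)

lemma C1_fun_Lipschitz_on_cball: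
  assumes "C1_fun f"
  obtains L where "L \<ge> 0" "\<And>x y. x \<in> cball z r \<Longrightarrow> y \<in> cball z r \<Longrightarrow> \<bar>f x - f y\<bar> \<le> L * norm (x - y)"
proof -
  have "compact (grad f ` cball z r)"
    using continuous_on_grad[OF assms] by (intro compact_continuous_image) auto
  then obtain L where "L > 0" and L: "\<And>x. x \<in> cball z r \<Longrightarrow> norm (grad f x) \<le> L"
    using compact_imp_bounded by (force simp: bounded_pos)
  show ?thesis
  proof (rule that[of L])
    fix x y assume "x \<in> cball z r" "y \<in> cball z r"
    moreover have "(f has_derivative (\<lambda>h. grad f x \<bullet> h)) (at x within cball z r)" for x
      using has_derivative_grad[OF assms] by (rule has_derivative_at_withinI)
    moreover have "onorm (\<lambda>h. grad f x \<bullet> h) \<le> L" if "x \<in> cball z r" for x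
    proof (rule onorm_le)
      fix h
      have "norm (grad f x \<bullet> h) \<le> norm (grad f x) * norm h"
        by (simp add: Cauchy_Schwarz_ineq2)
      also have "\<dots> \<le> L * norm h" using L[OF that] by (intro mult_right_mono) auto
      finally show "norm (grad f x \<bullet> h) \<le> L * norm h" .
    qed
    ultimately show "\<bar>f x - f y\<bar> \<le> L * norm (x - y)"
      using differentiable_bound[of "cball z r" f "\<lambda>x h. grad f x \<bullet> h" L x y] by auto
  qed (use \<open>L > 0\<close> in simp)
qed

lemma C2_fun_grad_Lipschitz_on_cball:
  assumes "C2_fun f"
  obtains L where "L \<ge> 0"
    "\<And>x y. x \<in> cball z r \<Longrightarrow> y \<in> cball z r \<Longrightarrow> norm (grad f x - grad f y) \<le> L * norm (x - y)"
proof -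
  have "\<exists>L\<ge>0. \<forall>x\<in>cball z r. \<forall>y\<in>cball z r. \<bar>pderiv_dir f b x - pderiv_dir f b y\<bar> \<le> L * norm (x - y)" if "b \<in> Basis" for b
    using C1_fun_Lipschitz_on_cball[of "pderiv_dir f b" z r] assms that unfolding C2_fun_def by metis
  then obtain L where L: "\<And>b. b \<in> Basis \<Longrightarrow> L b \<ge> 0"
    "\<And>b x y. b \<in> Basis \<Longrightarrow> x \<in> cball z r \<Longrightarrow> y \<in> cball z r \<Longrightarrow> \<bar>pderiv_dir f b x - pderiv_dir f b y\<bar> \<le> L b * norm (x - y)"
    by metis
  show ?thesis
  proof (rule that[of "\<Sum>b\<in>Basis. L b"])
    fix x y assume xy: "x \<in> cball z r" "y \<in> cball z r"
    have "norm (grad f x - grad f y) \<le> (\<Sum>b\<in>Basis. \<bar>(grad f x - grad f y) \<bullet> b\<bar>)"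
      by (rule norm_le_l1)
    also have "\<dots> = (\<Sum>b\<in>Basis. \<bar>pderiv_dir f b x - pderiv_dir f b y\<bar>)"
      by (intro sum.cong) (auto simp: grad_def inner_diff_left)
    also have "\<dots> \<le> (\<Sum>b\<in>Basis. L b * norm (x - y))"
      using L xy by (intro sum_mono) auto
    finally show "norm (grad f x - grad f y) \<le> (\<Sum>b\<in>Basis. L b) * norm (x - y)"
      by (simp add: sum_distrib_right)
  qed (use L in \<open>auto intro: sum_nonneg\<close>)
qed

text \<open>A single mean-value point gives the opening \<open>L\<close> instead of the sharp
  \<open>L / 2\<close>; some fixed constant is enough.\<close>

lemma C2_fun_taylor_le:
  assumes f: "C2_fun f"
    and L: "\<And>x y. x \<in> cball z0 r \<Longrightarrow> y \<in> cball z0 r \<Longrightarrow> norm (grad f x - grad f y) \<le> L * norm (x - y)"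
    and "L \<ge> 0" and xz: "x \<in> cball z0 r" "z \<in> cball z0 r"
  shows "f x \<le> f z + grad f z \<bullet> (x - z) + L * (norm (x - z))\<^sup>2"
proof -
  have C1: "C1_fun f" using f by (simp add: C2_fun_def)
  have "((\<lambda>t. f (z + t *\<^sub>R (x - z))) has_derivative (\<lambda>s. grad f (z + t *\<^sub>R (x - z)) \<bullet> (s *\<^sub>R (x - z)))) (at t)" for t
    by (rule has_derivative_compose[OF _ has_derivative_grad[OF C1]]) (auto intro!: derivative_eq_intros)
  then have D: "((\<lambda>t. f (z + t *\<^sub>R (x - z))) has_derivative (\<lambda>s. grad f (z + t *\<^sub>R (x - z)) \<bullet> (s *\<^sub>R (x - z)))) (at t within {0..1})" for t
    by (rule has_derivative_at_withinI)
  obtain \<xi> where \<xi>: "\<xi> \<in> {0..1}" "f (z + 1 *\<^sub>R (x - z)) - f (z + 0 *\<^sub>R (x - z)) = grad f (z + \<xi> *\<^sub>R (x - z)) \<bullet> ((1 - 0) *\<^sub>R (x - z))"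
    using mvt_very_simple[of 0 1 "\<lambda>t. f (z + t *\<^sub>R (x - z))" "\<lambda>t s. grad f (z + t *\<^sub>R (x - z)) \<bullet> (s *\<^sub>R (x - z))"] D by auto
  define y where "y = z + \<xi> *\<^sub>R (x - z)"
  have "y = (1 - \<xi>) *\<^sub>R z + \<xi> *\<^sub>R x" by (simp add: y_def algebra_simps)
  then have y: "y \<in> cball z0 r"
    using convexD_alt[OF convex_cball xz(2,1), of \<xi>] \<xi>(1) by simp
  have "f x = f z + grad f z \<bullet> (x - z) + (grad f y - grad f z) \<bullet> (x - z)"
    using \<xi>(2) by (simp add: y_def inner_diff_left algebra_simps)
  also have "(grad f y - grad f z) \<bullet> (x - z) \<le> norm (grad f y - grad f z) * norm (x - z)"
    by (rule norm_cauchy_schwarz)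
  also have "\<dots> \<le> (L * norm (y - z)) * norm (x - z)"
    using L[OF y xz(2)] by (intro mult_right_mono) auto
  also have "\<dots> \<le> (L * norm (x - z)) * norm (x - z)"
  proof (intro mult_right_mono mult_left_mono)
    show "norm (y - z) \<le> norm (x - z)"
      using \<xi>(1) by (simp add: y_def mult_left_le_one_le)
  qed (use \<open>L \<ge> 0\<close> in auto)
  finally show ?thesis by (simp add: power2_eq_square mult.assoc)
qed

text \<open>The centre lies at distance \<open>R\<close> from \<open>z\<close> against the gradient
  of \<open>\<rho>\<close>. For \<open>x\<close> in the ball this makes the linear term of
  \<open>\<rho>\<close> at \<open>z\<close> less than
  \<open>- G / (2 * R) * (norm (x - z))\<^sup>2\<close>, which beats the quadratic error
  \<open>L * (norm (x - z))\<^sup>2\<close> once \<open>2 * R * L <= G\<close>.\<close>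

lemma local_interior_ball:
  assumes \<rho>: "C2_fun \<rho>" "grad \<rho> z0 \<noteq> 0" and "r > 0"
    and level: "\<And>x. x \<in> ball z0 r \<Longrightarrow> x \<in> \<Omega> \<longleftrightarrow> \<rho> x < 0"
  obtains d R0 where "d > 0" "R0 > 0"
    "\<And>z R. \<lbrakk>z \<in> frontier \<Omega>; dist z0 z < d; 0 < R; R \<le> R0\<rbrakk> \<Longrightarrow> \<exists>y. norm (z - y) = R \<and> ball y R \<subseteq> \<Omega>"
proof -
  have C1: "C1_fun \<rho>" using \<rho> by (simp add: C2_fun_def)
  have cont\<rho>: "continuous_on UNIV \<rho>"
    using C1 unfolding C1_fun_def
    by (metis continuous_at_imp_continuous_on differentiable_imp_continuous_within)
  obtain L where "L \<ge> 0" and L: "\<And>x y. x \<in> cball z0 r \<Longrightarrow> y \<in> cball z0 r \<Longrightarrow> norm (grad \<rho> x - grad \<rho> y) \<le> L * norm (x - y)"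
    using C2_fun_grad_Lipschitz_on_cball[OF \<rho>(1), of z0 r] by blast
  define m where "m = norm (grad \<rho> z0) / 2"
  have "m > 0" using \<rho> by (simp add: m_def)
  \<comment> \<open>Within \<open>d\<close> of \<open>z0\<close> the gradient keeps at least half
    its norm. Using \<open>L + 1\<close> avoids division by zero.\<close>
  define d where "d = min (r / 2) (m / (L + 1))"
  have "d > 0" using \<open>r > 0\<close> \<open>m > 0\<close> \<open>L \<ge> 0\<close> by (simp add: d_def)
  define R0 where "R0 = min (r / 8) (m / (4 * (L + 1)))"
  have "R0 > 0" using \<open>r > 0\<close> \<open>m > 0\<close> \<open>L \<ge> 0\<close> by (simp add: R0_def)
  show ?thesis
  proof (rule that[OF \<open>d > 0\<close> \<open>R0 > 0\<close>])
    fix z R assume z: "z \<in> frontier \<Omega>" "dist z0 z < d" and R: "0 < R" "R \<le> R0"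
    have zr: "dist z0 z < r / 2" using z by (simp add: d_def)
    then have zc: "z \<in> ball z0 r" "z \<in> cball z0 r" using \<open>r > 0\<close> by auto
    have "norm (grad \<rho> z0 - grad \<rho> z) \<le> L * norm (z0 - z)"
      using L[of z0 z] zc \<open>r > 0\<close> by simp
    also have "\<dots> \<le> (L + 1) * norm (z0 - z)"
      by (intro mult_right_mono) auto
    also have "\<dots> \<le> m"
    proof -
      have "norm (z0 - z) \<le> m / (L + 1)" using z(2) by (simp add: d_def dist_norm)
      then show ?thesis using \<open>L \<ge> 0\<close> by (simp add: pos_le_divide_eq mult.commute)
    qed
    finally have gm: "norm (grad \<rho> z) \<ge> m"
      using norm_triangle_ineq2[of "grad \<rho> z0" "grad \<rho> z"] by (simp add: m_def)
    define G where "G = norm (grad \<rho> z)"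
    have "G > 0" using gm \<open>m > 0\<close> unfolding G_def by linarith
    define y where "y = z - (R / G) *\<^sub>R grad \<rho> z"
    have \<rho>z: "\<rho> z \<le> 0"
    proof (rule ccontr)
      assume "\<not> \<rho> z \<le> 0"
      then have "z \<in> ball z0 r \<inter> {x. \<rho> x > 0}" using zc by simp
      moreover have "open (ball z0 r \<inter> {x. \<rho> x > 0})"
        using cont\<rho> by (intro open_Int open_ball open_Collect_less) auto
      moreover have "z \<in> closure \<Omega>" using z by (simp add: frontier_def)
      ultimately obtain x where "x \<in> \<Omega>" "x \<in> ball z0 r" "\<rho> x > 0"
        by (metis (no_types, lifting) IntE closure_iff_nhds_not_empty disjoint_iff mem_Collect_eq order_refl)
      then show False using level[of x] by simp
    qed
    have "norm (z - y) = R"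
      using \<open>G > 0\<close> R by (simp add: y_def G_def)
    moreover have "ball y R \<subseteq> \<Omega>"
    proof
      fix x assume "x \<in> ball y R"
      then have xy: "norm (x - y) < R" by (simp add: dist_norm norm_minus_commute)
      have "norm (x - z) \<le> norm (x - y) + norm (z - y)"
        using norm_triangle_ineq4[of "x - y" "z - y"] by simp
      then have "norm (x - z) < 2 * R" using xy \<open>norm (z - y) = R\<close> by simp
      also have "\<dots> \<le> r / 2" using R \<open>r > 0\<close> by (simp add: R0_def)
      finally have "dist z x < r / 2" by (simp add: dist_norm norm_minus_commute)
      then have xb: "x \<in> ball z0 r" using zr dist_triangle[of z0 x z] by simp
      have "(norm (x - y))\<^sup>2 < R\<^sup>2" using xy by (intro power_strict_mono) auto
      moreover have "(norm (x - y))\<^sup>2 = (norm (x - z))\<^sup>2 + 2 * ((z - y) \<bullet> (x - z)) + (norm (z - y))\<^sup>2"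
        by (simp add: power2_norm_eq_inner inner_diff_left inner_diff_right inner_commute algebra_simps)
      moreover have "(z - y) \<bullet> (x - z) = R / G * (grad \<rho> z \<bullet> (x - z))"
        by (simp add: y_def)
      ultimately have "(norm (x - z))\<^sup>2 + 2 * (R / G * (grad \<rho> z \<bullet> (x - z))) < 0"
        using \<open>norm (z - y) = R\<close> by simp
      then have "2 * R * (grad \<rho> z \<bullet> (x - z)) < - (G * (norm (x - z))\<^sup>2)"
        using \<open>G > 0\<close> by (simp add: field_simps)
      moreover have "2 * R * (L * (norm (x - z))\<^sup>2) \<le> G * (norm (x - z))\<^sup>2"
      proof -
        have "R \<le> m / (4 * (L + 1))" using R by (simp add: R0_def)
        then have "R * (4 * (L + 1)) \<le> m" using \<open>L \<ge> 0\<close> by (simp add: pos_le_divide_eq)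
        moreover have "0 \<le> R * (2 * L + 4)" using R \<open>L \<ge> 0\<close> by simp
        ultimately have "2 * R * L \<le> G" using gm by (simp add: G_def algebra_simps)
        then have "2 * R * L * (norm (x - z))\<^sup>2 \<le> G * (norm (x - z))\<^sup>2" by (intro mult_right_mono) auto
        then show ?thesis by (simp add: mult.assoc)
      qed
      ultimately have "2 * R * (grad \<rho> z \<bullet> (x - z) + L * (norm (x - z))\<^sup>2) < 0"
        by (simp only: distrib_left)
      then have "grad \<rho> z \<bullet> (x - z) + L * (norm (x - z))\<^sup>2 < 0"
        using R by (simp add: mult_less_0_iff)
      moreover have "\<rho> x \<le> \<rho> z + grad \<rho> z \<bullet> (x - z) + L * (norm (x - z))\<^sup>2"
        using C2_fun_taylor_le[OF \<rho>(1) L \<open>L \<ge> 0\<close>] xb zc(2) by simp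
      ultimately have "\<rho> x < 0" using \<rho>z by linarith
      then show "x \<in> \<Omega>" using level[OF xb] by simp
    qed
    ultimately show "\<exists>y. norm (z - y) = R \<and> ball y R \<subseteq> \<Omega>" by blast
  qed
qed

lemma uniform_interior_ball:
  fixes \<Omega> :: "'a::euclidean_space set"
  assumes "bounded \<Omega>" "C2_boundary \<Omega>"
  obtains R0 where "R0 > 0"
    "\<And>z R. \<lbrakk>z \<in> frontier \<Omega>; 0 < R; R \<le> R0\<rbrakk> \<Longrightarrow> \<exists>y. norm (z - y) = R \<and> ball y R \<subseteq> \<Omega>"
proof -
  have "\<exists>d R0. d > 0 \<and> R0 > 0 \<and> (\<forall>z R. z \<in> frontier \<Omega> \<longrightarrow> dist z0 z < d \<longrightarrow> 0 < R \<longrightarrow> R \<le> R0 \<longrightarrow>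
      (\<exists>y. norm (z - y) = R \<and> ball y R \<subseteq> \<Omega>))" if z0: "z0 \<in> frontier \<Omega>" for z0
  proof -
    obtain r \<rho> where "r > 0" "C2_fun \<rho>" "grad \<rho> z0 \<noteq> 0" "\<forall>x\<in>ball z0 r. x \<in> \<Omega> \<longleftrightarrow> \<rho> x < 0"
      using assms(2) z0 unfolding C2_boundary_def by metis
    then obtain d R0 where "d > 0" "R0 > 0"
      "\<And>z R. \<lbrakk>z \<in> frontier \<Omega>; dist z0 z < d; 0 < R; R \<le> R0\<rbrakk> \<Longrightarrow> \<exists>y. norm (z - y) = R \<and> ball y R \<subseteq> \<Omega>"
      using local_interior_ball[of \<rho> z0 r \<Omega>] by metis
    then show ?thesis by blast
  qed
  then obtain d R0 where dR: "\<And>z0. z0 \<in> frontier \<Omega> \<Longrightarrow> d z0 > 0 \<and> R0 z0 > 0 \<and> (\<forall>z R. z \<in> frontier \<Omega> \<longrightarrow> dist z0 z < d z0 \<longrightarrow> 0 < R \<longrightarrow> R \<le> R0 z0 \<longrightarrow>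
      (\<exists>y. norm (z - y) = R \<and> ball y R \<subseteq> \<Omega>))"
    by metis
  have "compact (frontier \<Omega>)"
    using assms(1) by (simp add: compact_frontier_bounded)
  then obtain Z where Z: "Z \<subseteq> frontier \<Omega>" "finite Z" "frontier \<Omega> \<subseteq> (\<Union>z0\<in>Z. ball z0 (d z0))"
    using dR by (elim compactE_image[where C = "frontier \<Omega>" and f = "\<lambda>z0. ball z0 (d z0)"]) force+
  \<comment> \<open>The inserted 1 keeps the minimum meaningful if \<open>Z\<close> is
    empty.\<close>
  define R1 where "R1 = Min (insert 1 (R0 ` Z))"
  have "R1 > 0" using Z dR by (auto simp: R1_def)
  show ?thesis
  proof (rule that[OF \<open>R1 > 0\<close>])
    fix z R assume zR: "z \<in> frontier \<Omega>" "0 < R" "R \<le> R1"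
    then obtain z0 where z0: "z0 \<in> Z" "dist z0 z < d z0" using Z(3) by auto
    then have "R1 \<le> R0 z0" using Z(2) by (simp add: R1_def)
    then show "\<exists>y. norm (z - y) = R \<and> ball y R \<subseteq> \<Omega>"
      using dR[of z0] z0 Z(1) zR by (meson order_trans subsetD)
  qed
qed

subsection \<open>The first-order problem\<close>

text \<open>A constant touches \<open>u\<close> from below at its minimum over the closure. The
  state constraint makes this test legitimate even if the minimum is on the boundary.\<close>

lemma first_order_solution_nonneg:
  fixes x :: "'a::euclidean_space"
  assumes sol: "SC_solution lam p 0 \<Omega> f u" and lam: "lam > 0" and bd: "bounded \<Omega>"
    and f: "\<And>x. x \<in> closure \<Omega> \<Longrightarrow> f x \<ge> 0" and x: "x \<in> closure \<Omega>"
  shows "u x \<ge> 0"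
proof -
  have "compact (closure \<Omega>)" using bd by simp
  moreover have "closure \<Omega> \<noteq> {}" using x by (metis empty_iff)
  moreover have "continuous_on (closure \<Omega>) u" using sol unfolding SC_solution_def by (rule conjunct1)
  ultimately obtain x0 where x0: "x0 \<in> closure \<Omega>" "\<And>x. x \<in> closure \<Omega> \<Longrightarrow> u x0 \<le> u x"
    using continuous_attains_inf by metis
  then have "\<forall>\<^sub>F x in nhds x0. x \<in> closure \<Omega> \<longrightarrow> u x \<ge> u x0 + 0 \<bullet> (x - x0) + 0 * ((x - x0) \<bullet> (x - x0))"
    by simp
  from supersolution_quad[OF sol x0(1) this] have "lam * u x0 \<ge> f x0"
    by simp
  then have "u x0 \<ge> 0" using f[OF x0(1)] lam by (metis order_trans zero_le_mult_iff not_le)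
  then show ?thesis using x0(2)[OF x] by simp
qed

text \<open>Penalising by \<open>k * (norm (x - x0))\<^sup>2\<close> with
  \<open>k = B / r\<^sup>2\<close> makes \<open>\<Phi>\<close> nonpositive on the sphere, so its
  maximum is inside. There the gradient term has the favourable sign, and the possibly large slope
  needs no control.\<close>

lemma first_order_solution_nonpos:
  fixes x0 :: "'a::euclidean_space"
  assumes sol: "SC_solution lam p 0 \<Omega> f u" and lam: "lam > 0"
    and "r > 0" and ball: "cball x0 r \<subseteq> \<Omega>" and f0: "\<And>x. x \<in> cball x0 r \<Longrightarrow> f x = 0"
  shows "u x0 \<le> 0"
proof (rule ccontr)
  assume neg: "\<not> ?thesis"
  have cont: "continuous_on (cball x0 r) u"
    using sol ball closure_subset continuous_on_subset unfolding SC_solution_def by (metis order_trans)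
  then have "compact (u ` cball x0 r)" by (intro compact_continuous_image) auto
  then obtain B where "B > 0" and B: "\<And>x. x \<in> cball x0 r \<Longrightarrow> norm (u x) \<le> B"
    using compact_imp_bounded by (force simp: bounded_pos)
  define k where "k = B / r\<^sup>2"
  define \<Phi> where "\<Phi> x = u x - k * (norm (x - x0))\<^sup>2" for x
  have "continuous_on (cball x0 r) \<Phi>" unfolding \<Phi>_def by (intro continuous_intros cont)
  then obtain x1 where x1: "x1 \<in> cball x0 r" "\<And>x. x \<in> cball x0 r \<Longrightarrow> \<Phi> x \<le> \<Phi> x1"
    using continuous_attains_sup[of "cball x0 r" \<Phi>] \<open>r > 0\<close> by auto
  have "\<Phi> x1 \<ge> u x0" using x1(2)[of x0] \<open>r > 0\<close> by (simp add: \<Phi>_def)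
  have "norm (x1 - x0) \<noteq> r"
  proof
    assume "norm (x1 - x0) = r"
    then have "\<Phi> x1 = u x1 - B" using \<open>r > 0\<close> by (simp add: \<Phi>_def k_def)
    then show False using B[OF x1(1)] \<open>\<Phi> x1 \<ge> u x0\<close> neg by simp
  qed
  then have "x1 \<in> ball x0 r" using x1(1) by (auto simp: dist_norm norm_minus_commute)
  then have "\<forall>\<^sub>F x in nhds x1. x \<in> ball x0 r" by (intro eventually_nhds_in_open) auto
  then have "\<forall>\<^sub>F x in nhds x1. x \<in> \<Omega> \<longrightarrow> u x \<le> u x1 + ((2 * k) *\<^sub>R (x1 - x0)) \<bullet> (x - x1)
      + k * ((x - x1) \<bullet> (x - x1)) + 0 * (0 \<bullet> (x - x1))\<^sup>2"
  proof eventually_elim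
    case (elim x)
    have "u x \<le> u x1 + (k * (norm (x - x0))\<^sup>2 - k * (norm (x1 - x0))\<^sup>2)"
      using x1(2)[of x] elim by (simp add: \<Phi>_def)
    also have "k * (norm (x - x0))\<^sup>2 - k * (norm (x1 - x0))\<^sup>2
        = ((2 * k) *\<^sub>R (x1 - x0)) \<bullet> (x - x1) + k * ((x - x1) \<bullet> (x - x1))"
      by (simp add: power2_norm_eq_inner inner_diff_left inner_diff_right inner_commute algebra_simps)
    finally show ?case by simp
  qed
  moreover have "x1 \<in> \<Omega>" using x1(1) ball by blast
  ultimately have "lam * u x1 + norm ((2 * k) *\<^sub>R (x1 - x0)) powr p \<le> 0"
    using subsolution_quad[OF sol] f0[OF x1(1)] by fastforce
  then have "lam * u x1 \<le> 0" using powr_ge_zero[of "norm ((2 * k) *\<^sub>R (x1 - x0))" p] by linarith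
  then have "u x1 \<le> 0" using lam by (simp add: mult_le_0_iff)
  moreover have "\<Phi> x1 \<le> u x1" using \<open>B > 0\<close> by (simp add: \<Phi>_def k_def)
  ultimately show False using \<open>\<Phi> x1 \<ge> u x0\<close> neg by simp
qed

text \<open>In \<open>\<Omega>\<close> the extension agrees with \<open>u\<close>, and it is
  continuous because \<open>u\<close> vanishes on \<open>\<Omega> - S\<close>. Outside
  \<open>\<Omega>\<close> the value 0 is a minimum of the extension, so a paraboloid touching from
  above has slope 0, while the supersolution inequality is trivial.\<close>

lemma compact_support_solution_zero_extension:
  fixes \<Omega> :: "'a::euclidean_space set"
  assumes p: "p > 1" and lam: "lam > 0" and op: "open \<Omega>" and bd: "bounded \<Omega>"
    and cont: "continuous_on (closure \<Omega>) f" and f: "\<And>x. x \<in> closure \<Omega> \<Longrightarrow> f x \<ge> 0"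
    and S: "compact S" "S \<subseteq> \<Omega>" "\<And>x. x \<in> \<Omega> \<Longrightarrow> x \<notin> S \<Longrightarrow> f x = 0"
    and sol: "SC_solution lam p 0 \<Omega> f u"
  shows "compact_support_solution (\<lambda>x. if x \<in> \<Omega> then u x else 0) (\<lambda>x. if x \<in> \<Omega> then f x else 0) lam p S"
    (is "compact_support_solution ?U ?F lam p S")
proof -
  have u_nonneg: "u x \<ge> 0" if "x \<in> \<Omega>" for x
    using first_order_solution_nonneg[OF sol lam bd f] that closure_subset by blast
  have "closed S" using S(1) by (rule compact_imp_closed)
  have u_zero: "u x = 0" if x: "x \<in> \<Omega>" "x \<notin> S" for x
  proof -
    have "open (\<Omega> - S)" using op \<open>closed S\<close> by auto
    then obtain r where "r > 0" "cball x r \<subseteq> \<Omega> - S"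
      using x unfolding open_contains_cball by blast
    then have "u x \<le> 0"
      using S(3) by (intro first_order_solution_nonpos[OF sol lam \<open>r > 0\<close>]) auto
    then show ?thesis using u_nonneg[OF x(1)] by simp
  qed
  have ext: "continuous_on UNIV (\<lambda>x. if x \<in> \<Omega> then g x else 0)"
    if "continuous_on (closure \<Omega>) g" "\<And>x. x \<in> \<Omega> \<Longrightarrow> x \<notin> S \<Longrightarrow> g x = 0" for g :: "'a \<Rightarrow> real"
  proof -
    have "continuous_on \<Omega> g" using that(1) closure_subset continuous_on_subset by blast
    then have "continuous_on \<Omega> (\<lambda>x. if x \<in> \<Omega> then g x else 0)"
      by (simp cong: continuous_on_cong)
    moreover have "continuous_on (- S) (\<lambda>x. if x \<in> \<Omega> then g x else 0) \<longleftrightarrow> continuous_on (- S) (\<lambda>x. 0::real)"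
      using that(2) by (intro continuous_on_cong) auto
    ultimately have "continuous_on (\<Omega> \<union> - S) (\<lambda>x. if x \<in> \<Omega> then g x else 0)"
      using op \<open>closed S\<close> by (intro continuous_on_open_Un) auto
    moreover have "\<Omega> \<union> - S = UNIV" using S(2) by auto
    ultimately show ?thesis by simp
  qed
  have nhds: "\<forall>\<^sub>F y in nhds x. y \<in> \<Omega>" if "x \<in> \<Omega>" for x
    using op that by (rule eventually_nhds_in_open)
  show ?thesis
  proof
    show "continuous_on UNIV ?U" "continuous_on UNIV ?F"
      using sol cont u_zero S(3) by (auto intro!: ext simp: SC_solution_def)
    show "?U x \<ge> 0" "?F x \<ge> 0" for x
      using u_nonneg f[of x] closure_subset[of \<Omega>] by auto
    show "?U x = 0" "?F x = 0" if "x \<notin> S" for x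
      using u_zero S(3) that by auto
  next
    fix x q :: 'a and K :: real
    assume touch: "\<And>h. ?U (x + h) \<le> ?U x + q \<bullet> h + K * (norm h)\<^sup>2"
    show "lam * ?U x + norm q powr p \<le> ?F x"
    proof (cases "x \<in> \<Omega>")
      case True
      have "u y \<le> u x + q \<bullet> (y - x) + K * ((y - x) \<bullet> (y - x)) + 0 * (0 \<bullet> (y - x))\<^sup>2" if "y \<in> \<Omega>" for y
        using touch[of "y - x"] that True by (simp add: power2_norm_eq_inner)
      then have "\<forall>\<^sub>F y in nhds x. y \<in> \<Omega> \<longrightarrow> u y \<le> u x + q \<bullet> (y - x) + K * ((y - x) \<bullet> (y - x)) + 0 * (0 \<bullet> (y - x))\<^sup>2"
        by simp
      from subsolution_quad[OF sol True this] True show ?thesis by simp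
    next
      case False
      have ge: "0 \<le> q \<bullet> h + K * (norm h)\<^sup>2" for h
      proof -
        have "?U (x + h) \<ge> 0" using u_nonneg by auto
        then show ?thesis using touch[of h] False by simp
      qed
      \<comment> \<open>A step \<open>- s\<close> along \<open>q\<close> gives
        \<open>s * (norm q)\<^sup>2 * (K * s - 1) >= 0\<close>, and \<open>K * s < 1\<close> then
        forces \<open>q = 0\<close>.\<close>
      define s where "s = 1 / (\<bar>K\<bar> + 1)"
      have s: "s > 0" "K * s < 1" by (auto simp: s_def divide_simps)
      have "s * (norm q)\<^sup>2 * (K * s - 1) \<ge> 0"
        using ge[of "- (s *\<^sub>R q)"] s(1)
        by (simp add: power_mult_distrib algebra_simps power2_eq_square dot_square_norm)
      then have "q = 0" using s by (simp add: zero_le_mult_iff mult_le_0_iff)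
      then show ?thesis using False by simp
    qed
  next
    fix x q :: 'a and K r :: real
    assume "r > 0" and touch: "\<And>h. norm h < r \<Longrightarrow> ?U (x + h) \<ge> ?U x + q \<bullet> h - K * (norm h)\<^sup>2"
    show "lam * ?U x + norm q powr p \<ge> ?F x"
    proof (cases "x \<in> \<Omega>")
      case True
      have "\<forall>\<^sub>F y in nhds x. y \<in> ball x r" using \<open>r > 0\<close> by (intro eventually_nhds_in_open) auto
      then have "\<forall>\<^sub>F y in nhds x. y \<in> closure \<Omega> \<longrightarrow> u y \<ge> u x + q \<bullet> (y - x) + (- K) * ((y - x) \<bullet> (y - x))"
        using nhds[OF True]
      proof eventually_elim
        case (elim y)
        then have "norm (y - x) < r" by (simp add: dist_norm norm_minus_commute)
        then show ?case
          using touch[of "y - x"] True elim by (simp add: power2_norm_eq_inner)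
      qed
      moreover have "x \<in> closure \<Omega>" using True closure_subset by blast
      ultimately show ?thesis using supersolution_quad[OF sol] True by fastforce
    qed simp
  qed (use p lam S in auto)
qed

text \<open>Nonnegativity settles pairs outside \<open>S\<close>, and boundedness settles pairs more
  than \<open>\<delta>\<close> apart. A close pair meeting \<open>S\<close> spans a segment inside a
  ball in \<open>\<Omega>\<close>, where semiconcavity of \<open>f\<close> applies.\<close>

lemma semiconcave_zero_extension:
  fixes \<Omega> :: "'a::euclidean_space set"
  assumes sc: "semiconcave_on \<Omega> f" and S: "\<And>x. x \<in> \<Omega> \<Longrightarrow> x \<notin> S \<Longrightarrow> f x = 0"
    and "\<delta> > 0" and nbhd: "\<And>x. x \<in> S \<Longrightarrow> cball x \<delta> \<subseteq> \<Omega>"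
    and f: "\<And>x. x \<in> \<Omega> \<Longrightarrow> 0 \<le> f x" "\<And>x. x \<in> \<Omega> \<Longrightarrow> f x \<le> B" and "B \<ge> 0"
  defines "F \<equiv> \<lambda>x. if x \<in> \<Omega> then f x else 0"
  obtains K where "\<And>x z. F x + F z - 2 * F ((1 / 2) *\<^sub>R (x + z)) \<le> K * (norm (x - z))\<^sup>2"
proof -
  obtain K0 where K0: "\<And>x y t. \<lbrakk>closed_segment x y \<subseteq> \<Omega>; t \<in> {0..1}\<rbrakk> \<Longrightarrow>
      t * f x + (1 - t) * f y - f (t *\<^sub>R x + (1 - t) *\<^sub>R y) \<le> t * (1 - t) * (K0 * (norm (x - y))\<^sup>2 / 2)"
    using sc unfolding semiconcave_on_def by blast
  define K where "K = max (\<bar>K0\<bar> / 4) (2 * B / \<delta>\<^sup>2)"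
  have F: "0 \<le> F x" "F x \<le> B" for x using f \<open>B \<ge> 0\<close> by (auto simp: F_def)
  have F0: "F x = 0" if "x \<notin> S" for x using S that by (simp add: F_def)
  have "F x + F z - 2 * F ((1 / 2) *\<^sub>R (x + z)) \<le> K * (norm (x - z))\<^sup>2" for x z
  proof -
    have "K \<ge> 0" unfolding K_def by (rule max.coboundedI1) simp
    consider "x \<notin> S" "z \<notin> S" | "norm (x - z) > \<delta>" | "x \<in> S \<or> z \<in> S" "norm (x - z) \<le> \<delta>"
      by fastforce
    then show ?thesis
    proof cases
      case 1
      then have "F x + F z - 2 * F ((1 / 2) *\<^sub>R (x + z)) \<le> 0" using F(1) F0 by simp
      also have "0 \<le> K * (norm (x - z))\<^sup>2" using \<open>K \<ge> 0\<close> by simp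
      finally show ?thesis .
    next
      case 2
      have "2 * B / \<delta>\<^sup>2 * \<delta>\<^sup>2 \<le> K * (norm (x - z))\<^sup>2"
        using 2 \<open>\<delta> > 0\<close> \<open>K \<ge> 0\<close> by (intro mult_mono power_mono) (auto simp: K_def)
      then have "2 * B \<le> K * (norm (x - z))\<^sup>2" using \<open>\<delta> > 0\<close> by simp
      then show ?thesis using F(2)[of x] F(2)[of z] F(1)[of "(1 / 2) *\<^sub>R (x + z)"] by linarith
    next
      case 3
      then obtain c where "cball c \<delta> \<subseteq> \<Omega>" "x \<in> cball c \<delta>" "z \<in> cball c \<delta>"
        using nbhd \<open>\<delta> > 0\<close> by (fastforce simp: dist_norm norm_minus_commute)
      then have seg: "closed_segment x z \<subseteq> \<Omega>"
        using closed_segment_subset[OF _ _ convex_cball] by blast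
      have mid: "(1 / 2) *\<^sub>R x + (1 - 1 / 2) *\<^sub>R z = (1 / 2) *\<^sub>R (x + z)"
        by (simp add: algebra_simps)
      have "x \<in> closed_segment x z" "z \<in> closed_segment x z" "(1 / 2) *\<^sub>R (x + z) \<in> closed_segment x z"
        using midpoint_in_closed_segment[of x z] by (auto simp: midpoint_def)
      then have in\<Omega>: "x \<in> \<Omega>" "z \<in> \<Omega>" "(1 / 2) *\<^sub>R (x + z) \<in> \<Omega>" using seg by blast+
      have "F x + F z - 2 * F ((1 / 2) *\<^sub>R (x + z)) \<le> K0 / 4 * (norm (x - z))\<^sup>2"
        using K0[OF seg, of "1 / 2"] unfolding mid by (simp add: F_def in\<Omega>)
      also have "\<dots> \<le> K * (norm (x - z))\<^sup>2"
        by (intro mult_right_mono) (auto simp: K_def max_def)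
      finally show ?thesis .
    qed
  qed
  then show ?thesis by (rule that)
qed

section \<open>Combination of the interior and boundary estimates\<close>

theorem theorem1p2:
  fixes \<Omega> :: "'a::euclidean_space set" and f u :: "'a \<Rightarrow> real" and p lam :: real
  assumes "p > 2" and "0 < lam" and "lam < 1"
    and "open \<Omega>" and "bounded \<Omega>" and "C2_boundary \<Omega>"
    and "continuous_on (closure \<Omega>) f" and "\<forall>x\<in>closure \<Omega>. f x \<ge> 0"
    and "compact (closure {x\<in>closure \<Omega>. f x \<noteq> 0})"
    and "closure {x\<in>closure \<Omega>. f x \<noteq> 0} \<subseteq> \<Omega>"
    and "semiconcave_on \<Omega> f"
    and "SC_solution lam p 0 \<Omega> f u"
  shows "\<exists>\<epsilon>0>0. \<forall>\<epsilon>. 0 < \<epsilon> \<and> \<epsilon> < \<epsilon>0 \<longrightarrow> (\<forall>u\<epsilon>. SC_solution lam p \<epsilon> \<Omega> f u\<epsilon> \<longrightarrow>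
     (\<forall>x\<in>closure \<Omega>. u\<epsilon> x - u x \<le>
        (1 / lam + 2 powr ((p - 2) / (p - 1)) / ((p - 2) / (p - 1))) * \<epsilon> powr (1 - ((p - 2) / (p - 1)) / 2)))"
proof -
  note p = \<open>p > 2\<close> and lam = \<open>0 < lam\<close> and op = \<open>open \<Omega>\<close> and bd = \<open>bounded \<Omega>\<close>
    and sol = \<open>SC_solution lam p 0 \<Omega> f u\<close>
  define S where "S = closure {x\<in>closure \<Omega>. f x \<noteq> 0}"
  have S: "compact S" "S \<subseteq> \<Omega>" using assms by (auto simp: S_def)
  have f0: "f x = 0" if "x \<in> \<Omega>" "x \<notin> S" for x
    using that closure_subset[of \<Omega>] closure_subset[of "{x\<in>closure \<Omega>. f x \<noteq> 0}"] by (auto simp: S_def)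
  define U F where "U = (\<lambda>x. if x \<in> \<Omega> then u x else 0)" and "F = (\<lambda>x. if x \<in> \<Omega> then f x else 0)"
  interpret ext: compact_support_solution U F lam p S
    unfolding U_def F_def
    by (rule compact_support_solution_zero_extension[OF _ lam op bd _ _ S f0 sol]) (use assms in simp_all)
  obtain \<delta> where "\<delta> > 0" and \<delta>: "\<And>x. x \<in> S \<Longrightarrow> cball x \<delta> \<subseteq> \<Omega>"
    using compact_subset_open_imp_cball_epsilon_subset[OF S(1) op S(2)] by (metis UN_subset_iff)
  obtain B where "B > 0" and B: "\<And>x. F x \<le> B"
    using ext.bounded_support_fun[OF ext.cont_F ext.F_zero] by metis
  obtain K where K: "\<And>x z. F x + F z - 2 * F ((1 / 2) *\<^sub>R (x + z)) \<le> K * (norm (x - z))\<^sup>2"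
  proof (rule semiconcave_zero_extension[OF \<open>semiconcave_on \<Omega> f\<close> f0 \<open>\<delta> > 0\<close> \<delta>])
    show "0 \<le> f x" "f x \<le> B" if "x \<in> \<Omega>" for x
      using ext.F_nonneg[of x] B[of x] that by (auto simp: F_def)
  qed (use \<open>B > 0\<close> in \<open>auto simp: F_def\<close>)
  obtain C where "C > 0" and C: "\<And>y h. U (y + h) + U (y - h) - 2 * U y \<le> C * (norm h)\<^sup>2"
    using ext.semiconcave[OF K] by metis
  obtain R0 where "R0 > 0" and R0: "\<And>z R. \<lbrakk>z \<in> frontier \<Omega>; 0 < R; R \<le> R0\<rbrakk> \<Longrightarrow> \<exists>y. norm (z - y) = R \<and> ball y R \<subseteq> \<Omega>"
    using uniform_interior_ball[OF bd \<open>C2_boundary \<Omega>\<close>] by metis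
  obtain \<kappa> \<eta>0 where "\<kappa> > 0" "\<eta>0 > 0" and barrier:
    "\<And>\<eta> t. \<lbrakk>0 < \<eta>; \<eta> < \<eta>0; 0 < t; t \<le> bar_T p\<rbrakk> \<Longrightarrow>
       bar_c p \<eta> t + \<kappa> * bar_g p \<eta> t \<le> bar_g p \<eta> t powr p + 1"
    using barrier_inequality[OF p] by metis
  \<comment> \<open>A ball of radius \<open>R\<close> whose sphere passes through a boundary point
    has diameter at most \<open>\<delta>\<close>, so it misses \<open>S\<close> and \<open>f\<close>
    vanishes on it.\<close>
  define R where "R = min R0 (\<delta> / 2)"
  have R: "0 < R" "R \<le> R0" "2 * R \<le> \<delta>" using \<open>R0 > 0\<close> \<open>\<delta> > 0\<close> by (auto simp: R_def)
  define a where "a = (p - 2) / (p - 1)"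
  have a: "0 < a" "a < 1" using p by (auto simp: a_def)
  define Bd where "Bd \<epsilon> = (1 / lam + 2 powr a / a) * \<epsilon> powr (1 - a / 2)" for \<epsilon>
  have "((\<lambda>\<epsilon>::real. bar_T p * sqrt \<epsilon>) \<longlongrightarrow> bar_T p * sqrt 0) (at_right 0)"
    by (intro tendsto_intros)
  then have ev1: "\<forall>\<^sub>F \<epsilon> in at_right 0. bar_T p * sqrt \<epsilon> < R / 2"
    using R by (intro order_tendstoD) auto
  have "((\<lambda>\<epsilon>::real. 2 * DIM('a) * sqrt \<epsilon> / R) \<longlongrightarrow> 2 * DIM('a) * sqrt 0 / R) (at_right 0)"
    using R by (intro tendsto_intros) auto
  then have ev2: "\<forall>\<^sub>F \<epsilon> in at_right 0. 2 * DIM('a) * sqrt \<epsilon> / R < \<kappa>"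
    using \<open>\<kappa> > 0\<close> by (intro order_tendstoD) auto
  \<comment> \<open>\<open>\<epsilon> powr (a / 2)\<close> is the ratio of \<open>\<epsilon>\<close>
    to \<open>\<epsilon> powr (1 - a / 2)\<close>; its smallness puts the interior bound below the
    boundary one.\<close>
  have "((\<lambda>\<epsilon>::real. \<epsilon> powr (a / 2)) \<longlongrightarrow> 0) (at_right 0)"
    using a by (intro tendsto_zero_powrI[of _ _ _ "a / 2"]) (auto simp: tendsto_ident_at eventually_at_filter)
  then have "((\<lambda>\<epsilon>::real. DIM('a) * C * \<epsilon> powr (a / 2)) \<longlongrightarrow> DIM('a) * C * 0) (at_right 0)"
    by (intro tendsto_intros)
  then have ev3: "\<forall>\<^sub>F \<epsilon> in at_right 0. DIM('a) * C * \<epsilon> powr (a / 2) < 1"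
    by (intro order_tendstoD) auto
  have "\<forall>\<^sub>F \<epsilon> in at_right 0. \<forall>w. SC_solution lam p \<epsilon> \<Omega> f w \<longrightarrow> (\<forall>x\<in>closure \<Omega>. w x - u x \<le> Bd \<epsilon>)"
    using ev1 ev2 ev3 eventually_at_right_less[of 0]
  proof eventually_elim
    case (elim \<epsilon>)
    show ?case
    proof (intro allI impI ballI)
      fix w x assume w: "SC_solution lam p \<epsilon> \<Omega> f w" and x: "x \<in> closure \<Omega>"
      have cont_w: "continuous_on (closure \<Omega>) w" using w by (simp add: SC_solution_def)
      have compact_cl: "compact (closure \<Omega>)" using bd by simp
      then have "bounded (w ` closure \<Omega>)"
        using cont_w by (intro compact_imp_bounded compact_continuous_image)
      then obtain Bw where Bw: "\<And>x. x \<in> closure \<Omega> \<Longrightarrow> norm (w x) \<le> Bw" by (auto simp: bounded_iff)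
      have frontier: "w z \<le> Bd \<epsilon>" if z: "z \<in> frontier \<Omega>" for z
      proof -
        obtain y where y: "norm (z - y) = R" "ball y R \<subseteq> \<Omega>" using R0[OF z R(1,2)] by blast
        have sub: "ball y R \<subseteq> closure \<Omega>" using y(2) closure_subset by blast
        have z_notin: "z \<notin> \<Omega>" using z op by (simp add: frontier_def interior_open)
        have "w x \<le> Bd \<epsilon>" if "x \<in> ball y R" for x
          unfolding Bd_def a_def
        proof (rule state_constraint_ball_bound[OF p lam elim(4) R(1) w y(2) _ _ _ \<open>\<eta>0 > 0\<close> barrier _ _ that])
          fix x' assume x': "x' \<in> ball y R"
          have "dist x' z \<le> dist x' y + dist y z" by (rule dist_triangle)
          then have "z \<in> cball x' \<delta>" using x' y(1) R(3) by (simp add: dist_norm norm_minus_commute)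
          then have "x' \<notin> S" using \<delta> z_notin by blast
          then show "f x' = 0" using f0 y(2) x' by blast
          show "w x' \<le> Bw" using Bw[of x'] sub x' by fastforce
        next
          show "continuous_on (ball y R) w" using cont_w sub continuous_on_subset by blast
        qed (use elim in auto)
        moreover have "closure (ball y R) \<subseteq> closure \<Omega>" using y(2) by (rule closure_mono)
        moreover have "z \<in> closure (ball y R)" using y(1) R(1) by (simp add: dist_norm norm_minus_commute)
        ultimately show ?thesis
          using continuous_le_on_closure[of "ball y R" w z "Bd \<epsilon>"] continuous_on_subset[OF cont_w] by blast
      qed
      \<comment> \<open>\<open>Bd \<epsilon>\<close> is the threshold: a point where
        \<open>w\<close> exceeds it is interior by the boundary estimate. The additive error is
        \<open>\<epsilon>\<close> times the Laplacian \<open>DIM('a) * C\<close> of the touching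
        paraboloid.\<close>
      have "w x - U x \<le> max (Bd \<epsilon>) (\<epsilon> * (DIM('a) * C) / lam)"
      proof (rule ext.interior_comparison[OF C compact_cl cont_w _ x])
        fix x' q assume x': "x' \<in> closure \<Omega>" "Bd \<epsilon> < w x'"
          and touch: "\<And>h. x' + h \<in> closure \<Omega> \<Longrightarrow> w (x' + h) \<le> w x' + q \<bullet> h + C / 2 * (norm h)\<^sup>2"
        have "x' \<in> \<Omega>"
          using x' frontier[of x'] op by (force simp: frontier_def interior_open)
        moreover have "w y \<le> w x' + q \<bullet> (y - x') + C / 2 * ((y - x') \<bullet> (y - x')) + 0 * (0 \<bullet> (y - x'))\<^sup>2" if "y \<in> \<Omega>" for y
          using touch[of "y - x'"] that closure_subset[of \<Omega>] by (auto simp: power2_norm_eq_inner)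
        then have "\<forall>\<^sub>F y in nhds x'. y \<in> \<Omega> \<longrightarrow>
            w y \<le> w x' + q \<bullet> (y - x') + C / 2 * ((y - x') \<bullet> (y - x')) + 0 * (0 \<bullet> (y - x'))\<^sup>2"
          by simp
        ultimately show "lam * w x' + norm q powr p \<le> F x' + \<epsilon> * (DIM('a) * C)"
          using subsolution_quad[OF w, of x' q "C / 2" 0 0] by (simp add: F_def)
      qed
      also have "\<dots> = Bd \<epsilon>"
      proof -
        have "\<epsilon> = \<epsilon> powr (a / 2) * \<epsilon> powr (1 - a / 2)"
          using elim(4) by (simp add: powr_add[symmetric])
        then have "\<epsilon> * (DIM('a) * C) = DIM('a) * C * \<epsilon> powr (a / 2) * \<epsilon> powr (1 - a / 2)"
          by (metis mult.assoc mult.commute)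
        also have "\<dots> \<le> 1 * \<epsilon> powr (1 - a / 2)" using elim(3) by (intro mult_right_mono) auto
        finally have "\<epsilon> * (DIM('a) * C) / lam \<le> 1 / lam * \<epsilon> powr (1 - a / 2)"
          using lam by (simp add: divide_right_mono)
        also have "\<dots> \<le> Bd \<epsilon>"
          unfolding Bd_def using a by (intro mult_right_mono) auto
        finally show ?thesis by simp
      qed
      finally have "w x - U x \<le> Bd \<epsilon>" .
      \<comment> \<open>Equality holds in \<open>\<Omega>\<close>; on the boundary \<open>U\<close>
        is 0 by definition and \<open>u\<close> is nonnegative.\<close>
      moreover have "U x \<le> u x"
        using first_order_solution_nonneg[OF sol lam bd _ x] assms by (simp add: U_def)
      ultimately show "w x - u x \<le> Bd \<epsilon>" by simp
    qed
  qed
  then show ?thesis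
    unfolding eventually_at_right_field Bd_def a_def by auto
qed

end
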